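(* There is an absolute constant $c>0$ such that every connected graph $G$ on $n$ vertices with clique number $\kappa$ satisfies $rt(G)\le c\cdot\max(n-\kappa,1)$.
   Context: Routing via matchings: vertices of $G$ are labeled $1,\dots,n$ and each vertex $v$ initially holds a pebble $p_v$; a step consists of choosing a matching of $G$ and swapping the pebbles on the endpoints of each matched edge. For a permutation $\pi$, $rt(G,\pi)$ is the minimum number of steps after which each pebble $p_v$ lies on $\pi(v)$, and the routing number is $rt(G)=\max_\pi rt(G,\pi)$. *)

theory Defs
  imports
    "Graph_Theory.Graph_Theory"
    "HOL-Combinatorics.Permutations"
    "HOL-Library.Extended_Real"
begin

text \<open>
  Finite simple graphs are the \<^locale>\<open>pair_graph\<close>s of the library, in which an undirected
  edge between u and v is represented by the two arcs (u,v) and (v,u).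
\<close>

definition edges :: "'a pair_pre_digraph \<Rightarrow> 'a set set" where
  "edges G = {{u, v} | u v. (u, v) \<in> parcs G}"

definition is_clique :: "'a pair_pre_digraph \<Rightarrow> 'a set \<Rightarrow> bool" where
  "is_clique G K \<longleftrightarrow> K \<subseteq> pverts G \<and> pairwise (\<lambda>u v. (u, v) \<in> parcs G) K"

definition clique_number :: "'a pair_pre_digraph \<Rightarrow> nat" where
  "clique_number G = Max {card K | K. is_clique G K}"

text \<open>The empty matching is allowed, so a routing step may leave all pebbles in place.\<close>

definition is_matching :: "'a pair_pre_digraph \<Rightarrow> 'a set set \<Rightarrow> bool" where
  "is_matching G M \<longleftrightarrow> M \<subseteq> edges G \<and> pairwise disjnt M"

text \<open>The vertex on which the pebble from u lies after the swaps along the edges of M.\<close>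

definition swap_along :: "'a set set \<Rightarrow> 'a \<Rightarrow> 'a" where
  "swap_along M u = (if \<exists>v. {u, v} \<in> M then THE v. {u, v} \<in> M else u)"

lemma swap_along_edge:
  assumes "is_matching G M" "{u, v} \<in> M"
  shows "swap_along M u = v"
proof -
  have "w = v" if w: "{u, w} \<in> M" for w
  proof (rule ccontr)
    assume "w \<noteq> v"
    then have "{u, w} \<noteq> {u, v}" by (metis doubleton_eq_iff)
    then have "disjnt {u, w} {u, v}"
      using assms w by (metis is_matching_def pairwiseD)
    then show False by (simp add: disjnt_def)
  qed
  then have "(THE w. {u, w} \<in> M) = v" using assms(2) by (metis the_equality)
  then show ?thesis using assms(2) by (metis swap_along_def)
qed

text \<open>
  The matchings in the list are applied from left to right; the fold tracks the position of the
  pebble that starts on v.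
\<close>

definition routes :: "'a pair_pre_digraph \<Rightarrow> ('a \<Rightarrow> 'a) \<Rightarrow> 'a set set list \<Rightarrow> bool" where
  "routes G \<pi> Ms \<longleftrightarrow>
     (\<forall>M \<in> set Ms. is_matching G M) \<and> (\<forall>v \<in> pverts G. fold swap_along Ms v = \<pi> v)"

text \<open>
  The infimum over \<^typ>\<open>enat\<close> is a minimum if some sequence of matchings routes the
  permutation, and infinity otherwise. On a finite graph the supremum ranges over finitely many
  permutations, so it is a maximum.
\<close>

definition routing_number_perm :: "'a pair_pre_digraph \<Rightarrow> ('a \<Rightarrow> 'a) \<Rightarrow> enat" where
  "routing_number_perm G \<pi> = (INF Ms \<in> {Ms. routes G \<pi> Ms}. enat (length Ms))"

definition routing_number :: "'a pair_pre_digraph \<Rightarrow> enat" where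
  "routing_number G = (SUP \<pi> \<in> {\<pi>. \<pi> permutes pverts G}. routing_number_perm G \<pi>)"

end

theory Submission
  imports Defs
begin

text \<open>
  In a rooted tree the wave to a vertex \<open>v\<close> carries the token on the root down to \<open>v\<close> and shifts the
  tokens on the path up by one. Waves started two steps apart never meet, so \<open>k\<close> waves take only
  \<open>2 k\<close> steps plus the depth of the tree. Let \<open>m = n - \<kappa>\<close>.

  If \<open>\<kappa> < 3 m\<close>, a bound linear in \<open>n\<close> suffices. Choose a vertex \<open>r\<close> such that the remaining vertices
  split into connected parts, each adjacent to \<open>r\<close> and of size at most \<open>n / 2\<close>. A linear number of
  waves from \<open>r\<close> brings every token into its part, and the parts are then routed recursively and in
  parallel, so the total is a geometric sum.

  If \<open>\<kappa> \<ge> 3 m\<close>, a routing \<open>\<sigma>\<close> made of \<open>2 m\<close> waves, hence with \<open>O(m)\<close> steps, moves all tokens from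
  outside the clique \<open>K\<close> into \<open>K\<close>. A permutation of \<open>K\<close> is a product of two involutions and so takes
  two steps, and every permutation is a product of two of the form \<open>\<sigma>\<inverse> \<circ> \<rho>\<^sub>2 \<circ> \<sigma> \<circ> \<rho>\<^sub>1\<close> with \<open>\<rho>\<^sub>1\<close> and \<open>\<rho>\<^sub>2\<close>
  supported on \<open>K\<close>.
\<close>

section \<open>Permutations as sequences of matchings\<close>

text \<open>A matching is encoded as the involution of the whole type that exchanges the ends of its
  edges, so that steps can be composed and inverted as functions.\<close>

definition swap_step :: "'a rel \<Rightarrow> ('a \<Rightarrow> 'a) \<Rightarrow> bool" where
  "swap_step E s \<longleftrightarrow> (\<forall>x. s (s x) = x \<and> (s x \<noteq> x \<longrightarrow> (x, s x) \<in> E))"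

text \<open>The rightmost factor is the first step, in line with \<open>fold swap_along\<close>.
  Since \<open>id\<close> is a step, \<open>k\<close> acts as an upper bound.\<close>

primrec routable :: "'a rel \<Rightarrow> nat \<Rightarrow> ('a \<Rightarrow> 'a) \<Rightarrow> bool" where
  "routable E 0 \<pi> \<longleftrightarrow> \<pi> = id"
| "routable E (Suc k) \<pi> \<longleftrightarrow> (\<exists>s \<rho>. swap_step E s \<and> routable E k \<rho> \<and> \<pi> = \<rho> \<circ> s)"

lemma routable_SucI: "swap_step E s \<Longrightarrow> routable E k \<rho> \<Longrightarrow> routable E (Suc k) (\<rho> \<circ> s)"
  by auto

lemma swap_step_id [simp]: "swap_step E id"
  by (simp add: swap_step_def)

lemma swap_step_mono: "swap_step E s \<Longrightarrow> E \<subseteq> F \<Longrightarrow> swap_step F s"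
  by (auto simp: swap_step_def)

lemma swap_step_transpose:
  assumes "(a, b) \<in> E" "(b, a) \<in> E"
  shows "swap_step E (transpose a b)"
  using assms by (auto simp: swap_step_def transpose_def)

lemma swap_step_comp:
  assumes "swap_step E s" "swap_step E t" "\<And>x. s x = x \<or> t x = x"
  shows "swap_step E (s \<circ> t)"
  using assms unfolding swap_step_def comp_def by metis

lemma routable_id: "routable E k id"
  by (induction k) (auto intro: exI[of _ id])

lemma routable_mono_rel: "routable E k \<pi> \<Longrightarrow> E \<subseteq> F \<Longrightarrow> routable F k \<pi>"
  by (induction k arbitrary: \<pi>) (auto, metis swap_step_mono)

lemma routable_comp:
  "routable E k \<pi> \<Longrightarrow> routable E l \<rho> \<Longrightarrow> routable E (k + l) (\<rho> \<circ> \<pi>)"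
proof (induction k arbitrary: \<pi>)
  case (Suc k)
  then obtain s \<sigma> where s: "swap_step E s" "routable E k \<sigma>" "\<pi> = \<sigma> \<circ> s" by auto
  then have "routable E (k + l) (\<rho> \<circ> \<sigma>)" using Suc by blast
  then show ?case using routable_SucI[OF s(1)] s(3) by (metis add_Suc comp_assoc)
qed simp

lemma routable_mono:
  assumes "routable E k \<pi>" "k \<le> l"
  shows "routable E l \<pi>"
  using routable_comp[OF assms(1) routable_id[of E "l - k"]] assms(2) by simp

lemma routable_step: "swap_step E s \<Longrightarrow> routable E 1 s"
  by simp

lemma bij_swap_step: "swap_step E s \<Longrightarrow> bij s"
  unfolding swap_step_def by (metis bijI')

lemma inv_swap_step: "swap_step E s \<Longrightarrow> inv s = s"
  unfolding swap_step_def by (metis bij_swap_step inv_equality swap_step_def)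

lemma bij_routable: "routable E k \<pi> \<Longrightarrow> bij \<pi>"
  by (induction k arbitrary: \<pi>) (auto intro: bij_comp bij_swap_step)

lemma routable_inv: "routable E k \<pi> \<Longrightarrow> routable E k (inv \<pi>)"
proof (induction k arbitrary: \<pi>)
  case (Suc k)
  then obtain s \<sigma> where s: "swap_step E s" "routable E k \<sigma>" "\<pi> = \<sigma> \<circ> s" by auto
  then have "inv \<pi> = s \<circ> inv \<sigma>"
    by (metis bij_routable bij_swap_step inv_swap_step o_inv_distrib)
  then show ?case
    using routable_comp[OF Suc.IH[OF s(2)] routable_step[OF s(1)]] by (metis Suc_eq_plus1)
qed simp

lemma routable_moves: "routable E k \<pi> \<Longrightarrow> E \<subseteq> A \<times> A \<Longrightarrow> x \<notin> A \<Longrightarrow> \<pi> x = x"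
  by (induction k arbitrary: \<pi>) (auto simp: swap_step_def, metis SigmaD1 subsetD)

lemma routable_permutes: "routable E k \<pi> \<Longrightarrow> E \<subseteq> A \<times> A \<Longrightarrow> \<pi> permutes A"
  using bij_routable[of E k \<pi>] routable_moves[of E k \<pi> A]
  by (auto simp: permutes_def bij_iff)

text \<open>Steps on disjoint vertex sets commute, so the i-th steps of both routings merge into one
  matching.\<close>

lemma routable_parallel:
  assumes "E \<subseteq> A \<times> A" "F \<subseteq> B \<times> B" "A \<inter> B = {}"
  shows "routable E k \<pi> \<Longrightarrow> routable F k \<rho> \<Longrightarrow> routable (E \<union> F) k (\<pi> \<circ> \<rho>)"
proof (induction k arbitrary: \<pi> \<rho>)
  case (Suc k)
  then obtain s \<sigma> t \<tau> where s: "swap_step E s" "routable E k \<sigma>" "\<pi> = \<sigma> \<circ> s"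
    and t: "swap_step F t" "routable F k \<tau>" "\<rho> = \<tau> \<circ> t" by auto
  have s_out: "s x = x" if "x \<notin> A" for x
    using s(1) assms(1) that unfolding swap_step_def by blast
  have t_out: "t x = x" if "x \<notin> B" for x
    using t(1) assms(2) that unfolding swap_step_def by blast
  have s_in: "s x \<in> A" if "x \<in> A" for x
    using s(1) assms(1) that unfolding swap_step_def by (metis SigmaD2 subsetD)
  have \<tau>_out: "\<tau> x = x" if "x \<notin> B" for x
    using routable_moves[OF t(2) assms(2) that] .
  have \<tau>_in: "\<tau> x \<in> B" if "x \<in> B" for x
    using permutes_in_image[OF routable_permutes[OF t(2) assms(2)]] that by blast
  have comm: "s (\<tau> x) = \<tau> (s x)" for x
    using s_out \<tau>_out s_in \<tau>_in assms(3) by (metis disjoint_iff)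
  have "swap_step (E \<union> F) (s \<circ> t)"
    using s(1) t(1) assms(3) s_out t_out
    by (intro swap_step_comp) (auto intro: swap_step_mono)
  moreover have "\<pi> \<circ> \<rho> = (\<sigma> \<circ> \<tau>) \<circ> (s \<circ> t)"
    using s(3) t(3) comm by (auto simp: fun_eq_iff)
  ultimately show ?case
    using routable_SucI[OF _ Suc.IH[OF s(2) t(2)]] by metis
qed simp

text \<open>Each part is invariant, so \<open>\<pi>\<close> is the product of its restrictions to
  the parts. These are routed simultaneously, within the time of a single part.\<close>

lemma routable_Restr_Union:
  assumes "finite \<C>" "pairwise disjnt \<C>" "\<pi> permutes \<Union>\<C>"
    and "\<And>C. C \<in> \<C> \<Longrightarrow> \<pi> ` C \<subseteq> C"
    and "\<And>C \<rho>. C \<in> \<C> \<Longrightarrow> \<rho> permutes C \<Longrightarrow> routable (Restr E C) k \<rho>"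
    and "finite (\<Union>\<C>)"
  shows "routable (Restr E (\<Union>\<C>)) k \<pi>"
  using assms
proof (induction \<C> arbitrary: \<pi> rule: finite_induct)
  case empty
  then have "\<pi> = id" by simp
  then show ?case using routable_id by blast
next
  case (insert C \<C>)
  have fin: "finite C" "finite (\<Union>\<C>)" using insert.prems(5) by auto
  have disj: "C \<inter> \<Union>\<C> = {}"
    using insert.prems(1) insert.hyps(2) by (fastforce simp: pairwise_insert disjnt_def)
  have inj: "inj \<pi>" using insert.prems(2) by (rule permutes_inj)
  have onC: "\<pi> ` C = C"
    using insert.prems(3) inj fin by (meson endo_inj_surj inj_on_subset insertI1 subset_UNIV)
  have onU: "\<pi> ` \<Union>\<C> \<subseteq> \<Union>\<C>"
    using insert.prems(3) by blast
  have onU': "\<pi> ` \<Union>\<C> = \<Union>\<C>"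
    using onU inj fin by (meson endo_inj_surj inj_on_subset subset_UNIV)
  define \<sigma> where "\<sigma> = (\<lambda>x. if x \<in> C then \<pi> x else x)"
  define \<tau> where "\<tau> = (\<lambda>x. if x \<in> \<Union>\<C> then \<pi> x else x)"
  have \<sigma>: "\<sigma> permutes C"
    by (rule bij_imp_permutes)
      (use onC inj in \<open>auto simp: \<sigma>_def bij_betw_def inj_on_def inj_def image_def\<close>)
  have \<tau>: "\<tau> permutes \<Union>\<C>"
    by (rule bij_imp_permutes)
      (use onU' inj in \<open>auto simp: \<tau>_def bij_betw_def inj_on_def inj_def image_def\<close>)
  have eq: "\<pi> = \<sigma> \<circ> \<tau>"
  proof
    fix x
    have "\<tau> x \<notin> C" if "x \<in> \<Union>\<C>"
      using permutes_in_image[OF \<tau>] that disj by blast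
    moreover have "\<pi> x = x" if "x \<notin> C" "x \<notin> \<Union>\<C>"
      using permutes_not_in[OF insert.prems(2), of x] that by auto
    ultimately show "\<pi> x = (\<sigma> \<circ> \<tau>) x"
      using disj by (auto simp: \<sigma>_def \<tau>_def)
  qed
  have "routable (Restr E (\<Union>\<C>)) k \<tau>"
  proof (rule insert.IH)
    show "pairwise disjnt \<C>" using insert.prems(1) by (simp add: pairwise_insert)
    show "\<tau> ` D \<subseteq> D" if "D \<in> \<C>" for D
      using insert.prems(3)[of D] that by (auto simp: \<tau>_def)
  qed (use \<tau> insert.prems fin in auto)
  moreover have "routable (Restr E C) k \<sigma>" using insert.prems(4) \<sigma> by blast
  ultimately have "routable (Restr E C \<union> Restr E (\<Union>\<C>)) k \<pi>"
    unfolding eq using disj by (intro routable_parallel[of _ C _ "\<Union>\<C>"]) auto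
  then show ?case by (rule routable_mono_rel) auto
qed

section \<open>Pipelined waves\<close>

text \<open>
  With \<open>d\<close> the depth below the root, step \<open>i\<close> of a \<open>levelled\<close> routing acts at depth at most
  \<open>b + i\<close> and step \<open>i\<close> of a \<open>wave\<close> acts exactly on the edges between depths \<open>b + i\<close> and
  \<open>b + i + 1\<close>. Hence a wave that has a lead of two steps never meets the routing behind it.
\<close>

primrec levelled :: "'a rel \<Rightarrow> ('a \<Rightarrow> nat) \<Rightarrow> nat \<Rightarrow> nat \<Rightarrow> ('a \<Rightarrow> 'a) \<Rightarrow> bool" where
  "levelled E d 0 b \<pi> \<longleftrightarrow> \<pi> = id"
| "levelled E d (Suc k) b \<pi> \<longleftrightarrow> (\<exists>s \<rho>. swap_step E s \<and> (\<forall>x. s x \<noteq> x \<longrightarrow> d x \<le> b) \<and>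
     levelled E d k (Suc b) \<rho> \<and> \<pi> = \<rho> \<circ> s)"

primrec wave :: "'a rel \<Rightarrow> ('a \<Rightarrow> nat) \<Rightarrow> nat \<Rightarrow> nat \<Rightarrow> ('a \<Rightarrow> 'a) \<Rightarrow> bool" where
  "wave E d 0 b \<omega> \<longleftrightarrow> \<omega> = id"
| "wave E d (Suc k) b \<omega> \<longleftrightarrow> (\<exists>s \<rho>. swap_step E s \<and> (\<forall>x. s x \<noteq> x \<longrightarrow> d x = b \<or> d x = Suc b) \<and>
     wave E d k (Suc b) \<rho> \<and> \<omega> = \<rho> \<circ> s)"

lemma levelled_routable: "levelled E d k b \<pi> \<Longrightarrow> routable E k \<pi>"
  by (induction k arbitrary: b \<pi>) auto

lemma levelled_id: "levelled E d k b id"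
  by (induction k arbitrary: b) (auto intro: exI[of _ id])

lemma wave_moves: "wave E d k b \<omega> \<Longrightarrow> \<omega> x \<noteq> x \<Longrightarrow> b \<le> d x"
proof (induction k arbitrary: b \<omega> x)
  case (Suc k)
  then obtain s \<rho> where s: "swap_step E s" "\<forall>x. s x \<noteq> x \<longrightarrow> d x = b \<or> d x = Suc b"
    "wave E d k (Suc b) \<rho>" "\<omega> = \<rho> \<circ> s" by auto
  show ?case
  proof (cases "s x = x")
    case True
    then show ?thesis using Suc.IH[OF s(3), of x] Suc.prems(2) s(4) by auto
  qed (use s(2) in auto)
qed simp

lemma wave_bij: "wave E d k b \<omega> \<Longrightarrow> bij \<omega>"
  by (induction k arbitrary: b \<omega>) (auto intro: bij_comp bij_swap_step)

text \<open>The recursion of \<open>wave\<close> peels off the step nearest the root, whereas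
  building a wave along a path extends it at the lower end.\<close>

lemma wave_snoc:
  assumes "wave E d k b \<omega>" "swap_step E s" "\<And>x. s x \<noteq> x \<Longrightarrow> d x = b + k \<or> d x = Suc (b + k)"
  shows "wave E d (Suc k) b (s \<circ> \<omega>)"
  using assms
proof (induction k arbitrary: b \<omega>)
  case 0
  then show ?case by (auto intro!: exI[of _ s])
next
  case (Suc k)
  then obtain t \<rho> where t: "swap_step E t" "\<forall>x. t x \<noteq> x \<longrightarrow> d x = b \<or> d x = Suc b"
    "wave E d k (Suc b) \<rho>" "\<omega> = \<rho> \<circ> t" by auto
  have "wave E d (Suc k) (Suc b) (s \<circ> \<rho>)"
    using Suc.IH[OF t(3) Suc.prems(2)] Suc.prems(3) by (metis add_Suc_shift)
  then show ?case unfolding wave.simps(2)[of _ _ "Suc k"] t(4) comp_assoc[symmetric]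
    using t(1,2) by blast
qed

lemma wave_mono:
  assumes "wave E d k b \<omega>" "k \<le> l"
  shows "wave E d l b \<omega>"
  using assms(2)
proof (induction rule: dec_induct)
  case base
  show ?case by (rule assms(1))
next
  case (step n)
  show ?case using wave_snoc[OF step.IH swap_step_id] by simp
qed

text \<open>The remainder \<open>\<tau>\<close> of the wave moves only vertices deeper than
  \<open>b'\<close> and hence commutes with the first step \<open>s\<close> of \<open>\<pi>\<close>,
  which stays at depth at most \<open>b\<close>. So the two first steps merge. The new bound is
  \<open>Suc b'\<close> because the wave reaches that depth in its first step.\<close>

lemma levelled_wave_comp:
  assumes "levelled E d k b \<pi>" "wave E d k b' \<omega>" "b < b'"
  shows "levelled E d k (Suc b') (\<pi> \<circ> \<omega>)"
  using assms
proof (induction k arbitrary: b b' \<pi> \<omega>)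
  case (Suc k)
  then obtain s \<rho> where s: "swap_step E s" "\<forall>x. s x \<noteq> x \<longrightarrow> d x \<le> b"
    "levelled E d k (Suc b) \<rho>" "\<pi> = \<rho> \<circ> s" by auto
  from Suc.prems obtain t \<tau> where t: "swap_step E t" "\<forall>x. t x \<noteq> x \<longrightarrow> d x = b' \<or> d x = Suc b'"
    "wave E d k (Suc b') \<tau>" "\<omega> = \<tau> \<circ> t" by auto
  have "s (\<tau> x) = \<tau> (s x)" for x
  proof -
    have 1: "\<tau> y = y \<or> s y = y" for y
      using wave_moves[OF t(3), of y] s(2) Suc.prems(3) by fastforce
    have 2: "\<tau> (\<tau> y) \<noteq> \<tau> y" if "\<tau> y \<noteq> y" for y
      using wave_bij[OF t(3)] that by (metis bij_pointE)
    have 3: "s (s y) = y" for y using s(1) by (simp add: swap_step_def)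
    show ?thesis
      by (metis 1 2 3)
  qed
  then have eq: "\<pi> \<circ> \<omega> = (\<rho> \<circ> \<tau>) \<circ> (s \<circ> t)"
    using s(4) t(4) by (auto simp: fun_eq_iff)
  have "swap_step E (s \<circ> t)"
    using s(1,2) t(1,2) Suc.prems(3) by (intro swap_step_comp) fastforce+
  moreover have "d x \<le> Suc b'" if "(s \<circ> t) x \<noteq> x" for x
    using that s(2) t(2) Suc.prems(3) by (cases "t x = x") fastforce+
  moreover have "levelled E d k (Suc (Suc b')) (\<rho> \<circ> \<tau>)"
    using Suc.IH[OF s(3) t(3)] Suc.prems(3) by (metis Suc_less_eq)
  ultimately show ?case using eq by (metis levelled.simps(2))
qed simp

text \<open>The wave makes two steps alone; its next step starts at depth 2 while
  \<open>\<pi>\<close> starts at depth at most 1, so the other \<open>k\<close> steps run in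
  parallel. The first step touches only depths 0 and 1, which restores the bound 1 and lets further
  waves be put in front.\<close>

lemma levelled_wave:
  assumes "levelled E d k 1 \<pi>" "wave E d (Suc (Suc k)) 0 \<omega>"
  shows "levelled E d (Suc (Suc k)) 1 (\<pi> \<circ> \<omega>)"
proof -
  from assms(2) obtain s t \<tau> where s: "swap_step E s" "\<forall>x. s x \<noteq> x \<longrightarrow> d x = 0 \<or> d x = 1"
    and t: "swap_step E t" "\<forall>x. t x \<noteq> x \<longrightarrow> d x = 1 \<or> d x = 2"
    and \<tau>: "wave E d k 2 \<tau>" and \<omega>: "\<omega> = \<tau> \<circ> t \<circ> s"
    by (auto simp: numeral_2_eq_2)
  have l: "levelled E d k 3 (\<pi> \<circ> \<tau>)"
    using levelled_wave_comp[OF assms(1) \<tau>] by (simp add: numeral_3_eq_3 numeral_2_eq_2)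
  have "levelled E d (Suc k) 2 (\<pi> \<circ> \<tau> \<circ> t)"
    unfolding levelled.simps
    by (intro exI[of _ t] exI[of _ "\<pi> \<circ> \<tau>"]) (use l t in \<open>auto simp: eval_nat_numeral\<close>)
  then show ?thesis
    unfolding levelled.simps(2)[of _ _ "Suc k"] \<omega>
    by (intro exI[of _ s] exI[of _ "\<pi> \<circ> \<tau> \<circ> t"])
      (use s in \<open>auto simp: numeral_2_eq_2 comp_assoc simp del: levelled.simps\<close>)
qed

section \<open>Waves in a rooted tree\<close>

declare routable.simps(2) [simp del] levelled.simps(2) [simp del] wave.simps(2) [simp del]

lemma ex_deepest:
  fixes d :: "'a \<Rightarrow> nat"
  assumes "finite A" "A \<noteq> {}"
  shows "\<exists>u\<in>A. \<forall>w\<in>A. d w \<le> d u"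
proof -
  have "Max (d ` A) \<in> d ` A" using assms by simp
  then obtain u where "u \<in> A" "d u = Max (d ` A)" by auto
  then show ?thesis using assms by (metis Max_ge finite_imageI imageI)
qed

text \<open>The depth equation rules out cycles of parent pointers and thus makes \<open>par\<close>
  a spanning tree of \<open>S\<close>.\<close>

locale rooted_tree =
  fixes E :: "'a rel" and S :: "'a set" and r :: 'a and par :: "'a \<Rightarrow> 'a" and d :: "'a \<Rightarrow> nat"
  assumes root_in: "r \<in> S"
    and depth_root: "d r = 0"
    and par_in: "\<lbrakk>v \<in> S; v \<noteq> r\<rbrakk> \<Longrightarrow> par v \<in> S"
    and par_edge: "\<lbrakk>v \<in> S; v \<noteq> r\<rbrakk> \<Longrightarrow> (par v, v) \<in> E"
    and depth_par: "\<lbrakk>v \<in> S; v \<noteq> r\<rbrakk> \<Longrightarrow> d v = Suc (d (par v))"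
    and edge_sym: "sym E"
begin

text \<open>When nonempty, these are the subtrees containing the root. A wave ending in such a set
  does not disturb the settled vertices outside it.\<close>

definition up_closed :: "'a set \<Rightarrow> bool" where
  "up_closed U \<longleftrightarrow> U \<subseteq> S \<and> (\<forall>v \<in> U. v \<noteq> r \<longrightarrow> par v \<in> U)"

lemma up_closed_S: "up_closed S"
  by (simp add: up_closed_def par_in)

text \<open>Climbing from \<open>v\<close> meets every smaller depth. This serves to bound depths by
  numbers of vertices.\<close>

lemma ex_depth:
  assumes "v \<in> S" "k \<le> d v"
  shows "\<exists>u\<in>S. d u = k"
  using assms
proof (induction "d v" arbitrary: v)
  case 0
  then show ?case by auto
next
  case (Suc n)
  then have "v \<noteq> r" using depth_root by auto
  then have "par v \<in> S" "d v = Suc (d (par v))" using Suc.prems par_in depth_par by auto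
  then show ?case using Suc by (metis Suc_inject le_Suc_eq)
qed

text \<open>The wave to \<open>par v\<close> is extended by the swap of \<open>par v\<close> and
  \<open>v\<close>. It moves only vertices on the path from \<open>r\<close> to \<open>v\<close>,
  which is the least up-closed set containing \<open>v\<close>.\<close>

lemma ex_wave:
  assumes "v \<in> S"
  shows "\<exists>\<omega>. wave E d (d v) 0 \<omega> \<and> \<omega> r = v \<and>
    (\<forall>U x. up_closed U \<and> v \<in> U \<and> x \<notin> U \<longrightarrow> \<omega> x = x)"
  using assms
proof (induction "d v" arbitrary: v)
  case 0
  then have "v = r" using depth_par by force
  then show ?case using depth_root by (metis id_apply wave.simps(1))
next
  case (Suc n)
  then have "v \<noteq> r" using depth_root by auto
  then have p: "par v \<in> S" "d v = Suc (d (par v))" "(par v, v) \<in> E" "(v, par v) \<in> E"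
    using Suc.prems par_in depth_par par_edge edge_sym by (auto dest: symD)
  obtain \<omega> where \<omega>: "wave E d (d (par v)) 0 \<omega>" "\<omega> r = par v"
    "\<forall>U x. up_closed U \<and> par v \<in> U \<and> x \<notin> U \<longrightarrow> \<omega> x = x"
    using Suc.hyps(1)[of "par v"] Suc.hyps(2) p by auto
  have "wave E d (d v) 0 (transpose (par v) v \<circ> \<omega>)"
    unfolding p(2) by (intro wave_snoc[OF \<omega>(1)] swap_step_transpose)
      (use p in \<open>auto simp: transpose_def split: if_splits\<close>)
  moreover have "(transpose (par v) v \<circ> \<omega>) x = x" if "up_closed U" "v \<in> U" "x \<notin> U" for U x
  proof -
    have "par v \<in> U" using that \<open>v \<noteq> r\<close> by (simp add: up_closed_def)
    then show ?thesis using \<omega>(3) that by (auto simp: transpose_def)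
  qed
  ultimately show ?case using \<omega>(2) by (intro exI[of _ "transpose (par v) v \<circ> \<omega>"]) auto
qed

text \<open>\<open>D + 2 * k\<close> is the budget for \<open>k\<close> waves in a tree of depth at
  most \<open>D\<close>: each wave put in front costs two more steps.\<close>

lemma ex_leading_wave:
  assumes "v \<in> S" "\<forall>u\<in>S. d u \<le> D"
  obtains \<omega> where "\<omega> permutes S" "\<omega> r = v"
    "\<And>U x. \<lbrakk>up_closed U; v \<in> U; x \<notin> U\<rbrakk> \<Longrightarrow> \<omega> x = x"
    "\<And>k \<pi>. levelled E d (D + 2 * k) 1 \<pi> \<Longrightarrow> levelled E d (D + 2 * Suc k) 1 (\<pi> \<circ> \<omega>)"
proof -
  obtain \<omega> where \<omega>: "wave E d (d v) 0 \<omega>" "\<omega> r = v"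
    "\<And>U x. \<lbrakk>up_closed U; v \<in> U; x \<notin> U\<rbrakk> \<Longrightarrow> \<omega> x = x"
    using ex_wave[OF assms(1)] by blast
  have "\<omega> permutes S"
    using wave_bij[OF \<omega>(1)] \<omega>(3)[OF up_closed_S assms(1)] by (auto simp: permutes_def bij_iff)
  moreover have "levelled E d (D + 2 * Suc k) 1 (\<pi> \<circ> \<omega>)" if "levelled E d (D + 2 * k) 1 \<pi>" for k \<pi>
  proof -
    have "d v \<le> Suc (Suc (D + 2 * k))" using assms by force
    then have "wave E d (Suc (Suc (D + 2 * k))) 0 \<omega>" by (rule wave_mono[OF \<omega>(1)])
    from levelled_wave[OF that this] show ?thesis
      by (metis add_Suc_right mult_Suc_right add_2_eq_Suc)
  qed
  ultimately show ?thesis using that \<omega> by blast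
qed

text \<open>
  \<open>q x\<close> is the token on vertex \<open>x\<close> and \<open>c\<close> names the parts. Every token outside \<open>U\<close> already lies
  in its part. If the token on the root belongs to some other part, that part meets \<open>U\<close>, and a wave
  ending in a deepest such vertex settles it.
\<close>

lemma ex_waves_into_parts:
  assumes "finite S" "\<forall>u\<in>S. d u \<le> D"
    and c_par: "\<And>v. \<lbrakk>v \<in> S; v \<noteq> r; par v \<noteq> r\<rbrakk> \<Longrightarrow> c (par v) = c v"
    and c_root: "\<And>v. \<lbrakk>v \<in> S; v \<noteq> r\<rbrakk> \<Longrightarrow> c v \<noteq> c r"
    and "up_closed U" "r \<in> U" "q permutes S" "\<And>x. x \<in> S - U \<Longrightarrow> c (q x) = c x"
  shows "\<exists>\<rho>. levelled E d (D + 4 * card (U - {r})) 1 \<rho> \<and> (\<forall>x\<in>S. c (q (inv \<rho> x)) = c x)"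
  using assms(5-8)
proof (induction "card (U - {r})" arbitrary: U q)
  case (0 U q)
  have "finite U" using 0 assms(1) finite_subset by (auto simp: up_closed_def)
  then have "U - {r} = {}" using 0(1) by simp
  then have U: "U = {r}" using 0(3) by blast
  \<comment> \<open>A token foreign to the root would belong to a part \<open>C\<close> all of whose
    vertices already carry tokens of \<open>C\<close>, against injectivity of
    \<open>q\<close>.\<close>
  have "q r = r"
  proof (rule ccontr)
    assume ne: "q r \<noteq> r"
    define C where "C = {x \<in> S. c x = c (q r)}"
    have qr: "q r \<in> S" using 0 root_in permutes_in_image by metis
    have rC: "r \<notin> C" using c_root[OF qr ne] by (auto simp: C_def)
    have "q ` C \<subseteq> C"
      using 0 U rC permutes_in_image[OF 0(4)] by (fastforce simp: C_def)
    then have "q ` C = C"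
      using 0(4) assms(1) by (intro endo_inj_surj) (auto simp: C_def dest: permutes_inj_on)
    moreover have "q r \<in> C" using qr by (simp add: C_def)
    ultimately show False using rC permutes_inj[OF 0(4)] by (metis imageE injD)
  qed
  have "c (q x) = c x" if "x \<in> S" for x
    using 0(5)[of x] that U \<open>q r = r\<close> by (cases "x = r") simp_all
  moreover have "D + 4 * card (U - {r}) = D" using 0(1) by simp
  moreover have "levelled E d D 1 id" by (rule levelled_id)
  ultimately have "levelled E d (D + 4 * card (U - {r})) 1 id \<and> (\<forall>x\<in>S. c (q (inv id x)) = c x)"
    by simp
  then show ?case by (intro exI[where x = id])
next
  case (Suc n U q)
  have finU: "finite U" using Suc assms(1) finite_subset by (auto simp: up_closed_def)
  have US: "U \<subseteq> S" using Suc by (simp add: up_closed_def)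
  obtain u0 where u0: "u0 \<in> U" "u0 \<noteq> r"
    using Suc.hyps(2) by (metis DiffE card.empty ex_in_conv insertI1 nat.distinct(1) singletonI)
  \<comment> \<open>If the token on the root belongs there, a first wave replaces it by another one.
    Otherwise the wave to \<open>r\<close> keeps the count at two waves per vertex.\<close>
  define v where "v = (if q r = r then u0 else r)"
  have v: "v \<in> U" "v \<in> S" using u0 Suc.prems(2) US by (auto simp: v_def)
  obtain \<omega> where \<omega>: "\<omega> permutes S" "\<omega> r = v" "\<And>U x. \<lbrakk>up_closed U; v \<in> U; x \<notin> U\<rbrakk> \<Longrightarrow> \<omega> x = x"
    "\<And>k \<pi>. levelled E d (D + 2 * k) 1 \<pi> \<Longrightarrow> levelled E d (D + 2 * Suc k) 1 (\<pi> \<circ> \<omega>)"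
    using ex_leading_wave[OF v(2) assms(2)] by blast
  \<comment> \<open>After the wave, \<open>x\<close> holds the token that was on
    \<open>inv \<omega> x\<close>.\<close>
  define q1 where "q1 = q \<circ> inv \<omega>"
  have q1: "q1 permutes S" unfolding q1_def using Suc.prems(3) \<omega>(1)
    by (intro permutes_compose permutes_inv)
  have q1_out: "q1 x = q x" if "x \<notin> U" for x
  proof -
    have "inv \<omega> x = x" using \<omega>(3)[OF Suc.prems(1) v(1) that] \<omega>(1) by (metis permutes_inverses(2))
    then show ?thesis by (simp add: q1_def)
  qed
  have q1r: "q1 r \<noteq> r"
  proof (cases "q r = r")
    case True
    then have "inv \<omega> r \<noteq> r" using u0 \<omega>(1,2) by (metis permutes_inverses(1) v_def)
    then show ?thesis using True permutes_inj[OF Suc.prems(3)] by (metis comp_apply injD q1_def)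
  next
    case False
    then have "inv \<omega> r = r" using \<omega>(1,2) by (metis permutes_inverses(2) v_def)
    then show ?thesis using False by (simp add: q1_def)
  qed
  define C where "C = {x \<in> S. c x = c (q1 r)}"
  have q1r_in: "q1 r \<in> S" using q1 root_in permutes_in_image by metis
  have rC: "r \<notin> C" using c_root[OF q1r_in q1r] by (auto simp: C_def)
  \<comment> \<open>Otherwise \<open>C\<close> is completely settled and has no place left for the
    token on the root.\<close>
  have "C \<inter> U \<noteq> {}"
  proof
    assume e: "C \<inter> U = {}"
    have "q1 ` C \<subseteq> C"
    proof (rule image_subsetI)
      fix x assume x: "x \<in> C"
      then have "x \<in> S - U" using e by (auto simp: C_def)
      then have "c (q1 x) = c x" using q1_out[of x] Suc.prems(4)[of x] by simp
      then show "q1 x \<in> C" using x permutes_in_image[OF q1] by (auto simp: C_def)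
    qed
    then have "q1 ` C = C"
      using q1 assms(1) by (intro endo_inj_surj) (auto simp: C_def dest: permutes_inj_on)
    moreover have "q1 r \<in> C" using q1r_in by (simp add: C_def)
    ultimately show False using rC permutes_inj[OF q1] by (metis imageE injD)
  qed
  then obtain u where u: "u \<in> C \<inter> U" "\<forall>w \<in> C \<inter> U. d w \<le> d u"
    using ex_deepest[of "C \<inter> U" d] finU by blast
  have ur: "u \<noteq> r" "u \<in> S" using u rC by (auto simp: C_def)
  obtain \<theta> where \<theta>: "\<theta> permutes S" "\<theta> r = u" "\<And>U x. \<lbrakk>up_closed U; u \<in> U; x \<notin> U\<rbrakk> \<Longrightarrow> \<theta> x = x"
    "\<And>k \<pi>. levelled E d (D + 2 * k) 1 \<pi> \<Longrightarrow> levelled E d (D + 2 * Suc k) 1 (\<pi> \<circ> \<theta>)"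
    using ex_leading_wave[OF ur(2) assms(2)] by blast
  define q2 where "q2 = q1 \<circ> inv \<theta>"
  have q2: "q2 permutes S" unfolding q2_def using q1 \<theta>(1)
    by (intro permutes_compose permutes_inv)
  have q2_out: "q2 x = q x" if "x \<notin> U" for x
  proof -
    have "inv \<theta> x = x" using \<theta>(3)[OF Suc.prems(1) _ that] u \<theta>(1) by (metis IntD2 permutes_inverses(2))
    then show ?thesis using q1_out[OF that] by (simp add: q2_def)
  qed
  have q2u: "c (q2 u) = c u"
  proof -
    have "inv \<theta> u = r" using \<theta>(1,2) by (metis permutes_inverses(2))
    then show ?thesis using u by (simp add: q2_def C_def)
  qed
  \<comment> \<open>Children of \<open>u\<close> lie in the same part and are deeper, so by the
    choice of \<open>u\<close> none of them is in \<open>U\<close>.\<close>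
  have up: "up_closed (U - {u})"
    unfolding up_closed_def
  proof (intro conjI ballI impI)
    fix w assume w: "w \<in> U - {u}" "w \<noteq> r"
    have "par w \<in> U" using w Suc.prems(1) by (simp add: up_closed_def)
    moreover have "par w \<noteq> u"
    proof
      assume p: "par w = u"
      have wS: "w \<in> S" using w US by auto
      have "c w = c u" using c_par[OF wS w(2)] p ur by simp
      then have "w \<in> C \<inter> U" using w wS u by (simp add: C_def)
      then have "d w \<le> d u" using u(2) by blast
      then show False using depth_par[OF wS w(2)] p by simp
    qed
    ultimately show "par w \<in> U - {u}" by simp
  qed (use US in auto)
  have cd: "card (U - {u} - {r}) = n"
  proof -
    have "U - {r} - {u} = U - {u} - {r}" by auto
    moreover have "card (U - {r} - {u}) = n" using Suc.hyps(2) u ur finU by simp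
    ultimately show ?thesis by simp
  qed
  have "\<exists>\<rho>. levelled E d (D + 4 * card (U - {u} - {r})) 1 \<rho> \<and> (\<forall>x\<in>S. c (q2 (inv \<rho> x)) = c x)"
  proof (rule Suc.hyps(1))
    show "c (q2 x) = c x" if "x \<in> S - (U - {u})" for x
      using that q2_out[of x] q2u Suc.prems(4)[of x] by (cases "x = u") auto
  qed (use cd up Suc.prems ur q2 in auto)
  then obtain \<rho> where \<rho>: "levelled E d (D + 2 * (2 * n)) 1 \<rho>" "\<forall>x\<in>S. c (q2 (inv \<rho> x)) = c x"
    using cd by auto
  \<comment> \<open>Two waves of two steps each account for the 4 steps per vertex.\<close>
  have steps: "D + 2 * Suc (Suc (2 * n)) = D + 4 * card (U - {r})"
    using Suc.hyps(2) by simp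
  have "levelled E d (D + 4 * card (U - {r})) 1 (\<rho> \<circ> \<theta> \<circ> \<omega>)"
    using \<omega>(4)[OF \<theta>(4)[OF \<rho>(1)]] unfolding steps .
  moreover have "inv (\<rho> \<circ> \<theta> \<circ> \<omega>) = inv \<omega> \<circ> inv \<theta> \<circ> inv \<rho>"
    using bij_routable[OF levelled_routable[OF \<rho>(1)]] permutes_bij[OF \<theta>(1)] permutes_bij[OF \<omega>(1)]
    by (simp add: o_inv_distrib bij_comp comp_assoc)
  ultimately show ?case
    using \<rho>(2) by (intro exI[of _ "\<rho> \<circ> \<theta> \<circ> \<omega>"]) (simp add: q1_def q2_def)
qed

text \<open>
  The tokens from \<open>S - K\<close> leave \<open>S - K\<close>: its vertices are filled from the bottom up with tokens
  from \<open>K\<close>, each of which an extra wave inside \<open>K\<close> first brings to the root.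
\<close>

lemma ex_waves_evacuate:
  assumes "finite S" "\<forall>u\<in>S. d u \<le> D" "K \<subseteq> S" "r \<in> K" "\<And>k. \<lbrakk>k \<in> K; k \<noteq> r\<rbrakk> \<Longrightarrow> par k = r"
    and "card (S - K) < card K"
    and "up_closed (K \<union> U)" "U \<subseteq> S - K" "q permutes S" "\<And>x. x \<in> S - K - U \<Longrightarrow> q x \<in> K"
  shows "\<exists>\<rho>. levelled E d (D + 4 * card U) 1 \<rho> \<and> (\<forall>x\<in>S - K. q (inv \<rho> x) \<in> K)"
  using assms(7-10)
proof (induction "card U" arbitrary: U q)
  case (0 U q)
  have "finite U" using 0 assms(1) finite_subset by blast
  then have "U = {}" using 0 by auto
  then have "D + 4 * card U = D" "\<forall>x\<in>S - K. q x \<in> K" using 0 by auto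
  moreover have "levelled E d D 1 id" by (rule levelled_id)
  ultimately have "levelled E d (D + 4 * card U) 1 id \<and> (\<forall>x\<in>S - K. q (inv id x) \<in> K)"
    by simp
  then show ?case by (intro exI[where x = id])
next
  case (Suc n U q)
  have finU: "finite U" using Suc.prems(2) assms(1) by (meson finite_Diff finite_subset)
  have finK: "finite K" using assms(1,3) finite_subset by blast
  \<comment> \<open>There are too few tokens from \<open>S - K\<close> to occupy all of
    \<open>K\<close>.\<close>
  have "\<not> q ` K \<subseteq> S - K"
  proof
    assume "q ` K \<subseteq> S - K"
    then have "card K \<le> card (S - K)"
      using assms(1) permutes_inj_on[OF Suc.prems(3)] by (intro card_inj_on_le[of q]) auto
    then show False using assms(6) by simp
  qed
  then obtain k where k: "k \<in> K" "q k \<in> K"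
    using permutes_in_image[OF Suc.prems(3)] assms(3) by blast
  obtain \<omega> where \<omega>: "\<omega> permutes S" "\<omega> r = k" "\<And>U x. \<lbrakk>up_closed U; k \<in> U; x \<notin> U\<rbrakk> \<Longrightarrow> \<omega> x = x"
    "\<And>k \<pi>. levelled E d (D + 2 * k) 1 \<pi> \<Longrightarrow> levelled E d (D + 2 * Suc k) 1 (\<pi> \<circ> \<omega>)"
    using ex_leading_wave[of k, OF _ assms(2)] k assms(3) by blast
  \<comment> \<open>The parent of \<open>k\<close> is \<open>r\<close> unless \<open>k = r\<close>,
    so the wave to \<open>k\<close> only exchanges \<open>r\<close> and \<open>k\<close> and thereby
    fetches the token on \<open>k\<close> to the root.\<close>
  have up_k: "up_closed {r, k}"
    using assms(3,4,5) k by (auto simp: up_closed_def)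
  have \<omega>_out: "\<omega> x = x" if "x \<noteq> r" "x \<noteq> k" for x
    using \<omega>(3)[OF up_k] that by simp
  have "\<omega> k = r"
    using \<omega>_out \<omega>(1,2) permutes_inverses(1)[OF \<omega>(1), of r] by metis
  then have inv_\<omega>: "inv \<omega> r = k" using \<omega>(1) by (metis permutes_inverses(2))
  have inv_\<omega>_out: "inv \<omega> x = x" if "x \<notin> K" for x
    using \<omega>_out[of x] k that assms(4) \<omega>(1) by (metis permutes_inverses(2))
  obtain u where u: "u \<in> U" "\<forall>w \<in> U. d w \<le> d u"
    using ex_deepest[of U d] finU Suc.hyps(2) by fastforce
  have ur: "u \<in> S" "u \<notin> K" "u \<noteq> r" using u Suc.prems(2) assms(4) by auto
  obtain \<theta> where \<theta>: "\<theta> permutes S" "\<theta> r = u" "\<And>U x. \<lbrakk>up_closed U; u \<in> U; x \<notin> U\<rbrakk> \<Longrightarrow> \<theta> x = x"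
    "\<And>k \<pi>. levelled E d (D + 2 * k) 1 \<pi> \<Longrightarrow> levelled E d (D + 2 * Suc k) 1 (\<pi> \<circ> \<theta>)"
    using ex_leading_wave[OF ur(1) assms(2)] by blast
  define q2 where "q2 = q \<circ> inv \<omega> \<circ> inv \<theta>"
  have q2: "q2 permutes S" unfolding q2_def using Suc.prems(3) \<omega>(1) \<theta>(1)
    by (intro permutes_compose permutes_inv)
  have q2_out: "q2 x = q x" if "x \<notin> K" "x \<notin> U" for x
  proof -
    have "inv \<theta> x = x"
      using \<theta>(3)[OF Suc.prems(1), of x] u that \<theta>(1) by (metis UnE UnI2 permutes_inverses(2))
    then show ?thesis using inv_\<omega>_out[OF that(1)] by (simp add: q2_def)
  qed
  have q2u: "q2 u \<in> K"
  proof -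
    have "inv \<theta> u = r" using \<theta>(1,2) by (metis permutes_inverses(2))
    then show ?thesis using inv_\<omega> k by (simp add: q2_def)
  qed
  \<comment> \<open>Vertices of \<open>K\<close> other than \<open>r\<close> are children of
    \<open>r\<close>, and no vertex of \<open>U\<close> is deeper than \<open>u\<close>, so no child
    of \<open>u\<close> remains.\<close>
  have up: "up_closed (K \<union> (U - {u}))"
    unfolding up_closed_def
  proof (intro conjI ballI impI)
    fix w assume w: "w \<in> K \<union> (U - {u})" "w \<noteq> r"
    have "par w \<noteq> u"
    proof
      assume p: "par w = u"
      then have "w \<in> U" using w assms(5) ur by blast
      moreover have "d w = Suc (d u)" using depth_par[OF _ w(2)] p w assms(3) Suc.prems(2) by blast
      ultimately show False using u(2) by fastforce
    qed
    then show "par w \<in> K \<union> (U - {u})" using w Suc.prems(1) by (auto simp: up_closed_def)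
  qed (use assms(3) Suc.prems(2) in auto)
  have cd: "card (U - {u}) = n" using Suc.hyps(2) u finU by simp
  have "\<exists>\<rho>. levelled E d (D + 4 * card (U - {u})) 1 \<rho> \<and> (\<forall>x\<in>S - K. q2 (inv \<rho> x) \<in> K)"
  proof (rule Suc.hyps(1))
    show "q2 x \<in> K" if "x \<in> S - K - (U - {u})" for x
      using that q2_out[of x] q2u Suc.prems(4)[of x] by (cases "x = u") auto
  qed (use cd up Suc.prems q2 in auto)
  then obtain \<rho> where \<rho>: "levelled E d (D + 2 * (2 * n)) 1 \<rho>" "\<forall>x\<in>S - K. q2 (inv \<rho> x) \<in> K"
    using cd by auto
  have steps: "D + 2 * Suc (Suc (2 * n)) = D + 4 * card U"
    using Suc.hyps(2) by simp
  have "levelled E d (D + 4 * card U) 1 (\<rho> \<circ> \<theta> \<circ> \<omega>)"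
    using \<omega>(4)[OF \<theta>(4)[OF \<rho>(1)]] unfolding steps .
  moreover have "inv (\<rho> \<circ> \<theta> \<circ> \<omega>) = inv \<omega> \<circ> inv \<theta> \<circ> inv \<rho>"
    using bij_routable[OF levelled_routable[OF \<rho>(1)]] permutes_bij[OF \<theta>(1)] permutes_bij[OF \<omega>(1)]
    by (simp add: o_inv_distrib bij_comp comp_assoc)
  ultimately show ?case
    using \<rho>(2) by (intro exI[of _ "\<rho> \<circ> \<theta> \<circ> \<omega>"]) (simp add: q2_def)
qed

end

text \<open>Depth is the distance from \<open>r\<close>. Every neighbour of the root becomes its
  child, which puts a clique containing the root at depth at most 1.\<close>

lemma ex_bfs_tree:
  assumes "sym F" "F \<subseteq> S \<times> S" "r \<in> S" "\<And>v. v \<in> S \<Longrightarrow> (r, v) \<in> F\<^sup>*"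
  obtains par d where "rooted_tree F S r par d" "\<And>v. v \<noteq> r \<Longrightarrow> (r, v) \<in> F \<Longrightarrow> par v = r"
proof -
  define d where "d v = (LEAST k. (r, v) \<in> F ^^ k)" for v
  have d: "(r, v) \<in> F ^^ d v" if "v \<in> S" for v
    unfolding d_def by (rule LeastI_ex) (use assms(4)[OF that] rtrancl_imp_relpow in blast)
  have d_le: "d v \<le> k" if "(r, v) \<in> F ^^ k" for v k
    unfolding d_def using that by (rule Least_le)
  have edge: "d y \<le> Suc (d x)" if "(x, y) \<in> F" for x y
    using d_le[of y "Suc (d x)"] d[of x] that assms(2) by auto
  have dr: "d r = 0" using d_le[of r 0] by simp
  have ex: "\<exists>u. (u, v) \<in> F \<and> d v = Suc (d u) \<and> ((r, v) \<in> F \<longrightarrow> u = r)"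
    if v: "v \<in> S" "v \<noteq> r" for v
  proof -
    obtain k where k: "d v = Suc k" using d[OF v(1)] v(2) by (cases "d v") auto
    then obtain u where u: "(r, u) \<in> F ^^ k" "(u, v) \<in> F" using d[OF v(1)] by auto
    have "d u = k" using d_le[OF u(1)] edge[OF u(2)] k by simp
    show ?thesis
    proof (cases "(r, v) \<in> F")
      case True
      then have "d v = 1" using edge[OF True] dr k by simp
      then show ?thesis using True dr by (intro exI[of _ r]) simp
    qed (use u k \<open>d u = k\<close> in auto)
  qed
  define par where "par v = (SOME u. (u, v) \<in> F \<and> d v = Suc (d u) \<and> ((r, v) \<in> F \<longrightarrow> u = r))" for v
  have par: "(par v, v) \<in> F" "d v = Suc (d (par v))" "(r, v) \<in> F \<Longrightarrow> par v = r"
    if "v \<in> S" "v \<noteq> r" for v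
    using someI_ex[OF ex[OF that]] unfolding par_def by auto
  have "rooted_tree F S r par d"
    by unfold_locales (use assms dr par in \<open>auto dest: par(1)\<close>)
  then show ?thesis using that[of par d] par(3) assms(2) by blast
qed

section \<open>Routing on connected graphs\<close>

definition connected_on :: "'a rel \<Rightarrow> 'a set \<Rightarrow> bool" where
  "connected_on E S \<longleftrightarrow> S \<noteq> {} \<and> (\<forall>x\<in>S. \<forall>y\<in>S. (x, y) \<in> (Restr E S)\<^sup>*)"

text \<open>Edges between different parts are allowed, so the parts may be finer than the components
  of \<open>S - {r}\<close>. This freedom lets the root move to a neighbour in
  \<open>ex_balanced_split\<close>.\<close>

definition splits_at :: "'a rel \<Rightarrow> 'a set \<Rightarrow> 'a \<Rightarrow> 'a set set \<Rightarrow> bool" where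
  "splits_at E S r \<C> \<longleftrightarrow> r \<in> S \<and> pairwise disjnt \<C> \<and> \<Union>\<C> = S - {r} \<and>
     (\<forall>C\<in>\<C>. connected_on E C \<and> (\<exists>y\<in>C. (r, y) \<in> E))"

lemma sym_rtrancl_Restr: "sym E \<Longrightarrow> sym ((Restr E S)\<^sup>*)"
  by (intro sym_rtrancl) (auto simp: sym_def)

lemma rtrancl_Restr_mono: "(x, y) \<in> (Restr E S)\<^sup>* \<Longrightarrow> S \<subseteq> T \<Longrightarrow> (x, y) \<in> (Restr E T)\<^sup>*"
  by (rule subsetD[OF rtrancl_mono]) auto

lemma connected_on_hub:
  assumes "sym E" "h \<in> S" "\<And>x. x \<in> S \<Longrightarrow> (h, x) \<in> (Restr E S)\<^sup>*"
  shows "connected_on E S"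
  unfolding connected_on_def
proof (intro conjI ballI)
  show "S \<noteq> {}" using assms(2) by auto
  fix x y assume "x \<in> S" "y \<in> S"
  then show "(x, y) \<in> (Restr E S)\<^sup>*"
    using assms(3)[of x] assms(3)[of y] sym_rtrancl_Restr[OF assms(1)]
    by (meson rtrancl_trans symD)
qed

lemma ex_splits_at:
  assumes "sym E" "connected_on E S" "r \<in> S"
  shows "\<exists>\<C>. splits_at E S r \<C>"
proof -
  define R where "R = (Restr E (S - {r}))\<^sup>*"
  have symR: "sym R" unfolding R_def by (rule sym_rtrancl_Restr[OF assms(1)])
  have transR: "trans R" unfolding R_def by (rule trans_rtrancl)
  define \<C> where "\<C> = (\<lambda>x. R `` {x}) ` (S - {r})"
  have sub: "R `` {x} \<subseteq> S - {r}" if "x \<in> S - {r}" for x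
  proof
    fix y assume "y \<in> R `` {x}"
    then have "(x, y) \<in> (Restr E (S - {r}))\<^sup>*" by (simp add: R_def)
    then show "y \<in> S - {r}" using that by (induction rule: rtrancl_induct) auto
  qed
  have refl: "x \<in> R `` {x}" for x by (simp add: R_def)
  have "pairwise disjnt \<C>"
  proof (rule pairwiseI)
    fix A B assume AB: "A \<in> \<C>" "B \<in> \<C>" "A \<noteq> B"
    then obtain x y where x: "A = R `` {x}" "B = R `` {y}" by (auto simp: \<C>_def)
    show "disjnt A B"
    proof (rule ccontr)
      assume "\<not> disjnt A B"
      then obtain z where z: "(x, z) \<in> R" "(y, z) \<in> R" using x by (auto simp: disjnt_def)
      have "(x, y) \<in> R" "(y, x) \<in> R" using z symR transR by (meson symD transD)+
      then have "A = B" unfolding x using transR by (auto dest: transD)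
      then show False using AB by simp
    qed
  qed
  moreover have "\<Union>\<C> = S - {r}"
    using sub refl unfolding \<C>_def by fast
  moreover have "connected_on E C \<and> (\<exists>y\<in>C. (r, y) \<in> E)" if C: "C \<in> \<C>" for C
  proof -
    obtain x where x: "x \<in> S - {r}" "C = R `` {x}" using C by (auto simp: \<C>_def)
    have path: "(x, y) \<in> (Restr E C)\<^sup>*" if "y \<in> C" for y
    proof -
      have "(x, y) \<in> (Restr E (S - {r}))\<^sup>*" using that x by (simp add: R_def)
      then show ?thesis
      proof (induction rule: rtrancl_induct)
        case (step y z)
        then have "y \<in> C" "z \<in> C" using x by (auto simp: R_def intro: rtrancl_into_rtrancl)
        then show ?case using step by (auto intro: rtrancl_into_rtrancl)
      qed simp
    qed
    then have conn: "connected_on E C"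
      using connected_on_hub[OF assms(1), of x C] refl x by blast
    \<comment> \<open>A path from \<open>x\<close> to \<open>r\<close> can leave the component
      \<open>C\<close> of \<open>S - {r}\<close> only by an edge to \<open>r\<close>.\<close>
    have "\<exists>y\<in>C. (r, y) \<in> E"
    proof (rule ccontr)
      assume none: "\<not> (\<exists>y\<in>C. (r, y) \<in> E)"
      have "(x, r) \<in> (Restr E S)\<^sup>*" using assms(2,3) x by (auto simp: connected_on_def)
      then have "r \<in> C"
      proof (induction rule: rtrancl_induct)
        case base
        show ?case using refl x by simp
      next
        case (step y z)
        have "z \<noteq> r" using step none assms(1) by (auto dest: symD)
        moreover have "y \<in> S - {r}" using step(3) sub[OF x(1)] x(2) by blast
        ultimately have "(y, z) \<in> Restr E (S - {r})" using step(2) by auto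
        then show ?case using step(3) x(2) by (auto simp: R_def intro: rtrancl_into_rtrancl)
      qed
      then show False using sub[OF x(1)] x(2) by blast
    qed
    then show ?thesis using conn by simp
  qed
  ultimately show ?thesis using assms(3) unfolding splits_at_def by blast
qed

text \<open>As long as some part has more than half of the vertices, move the root into that part.\<close>

lemma ex_balanced_split:
  assumes "sym E" "finite S" "connected_on E S"
  shows "\<exists>r \<C>. splits_at E S r \<C> \<and> (\<forall>C\<in>\<C>. 2 * card C \<le> card S)"
proof -
  have *: "\<exists>r \<C>. splits_at E S r \<C> \<and> (\<forall>C\<in>\<C>. 2 * card C \<le> card S)"
    if "splits_at E S r \<C>" "\<forall>C\<in>\<C>. card C \<le> m" for r \<C> m
    using that
  proof (induction m arbitrary: r \<C>)
    case 0
    then show ?case by (intro exI[of _ r] exI[of _ \<C>]) auto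
  next
    case (Suc m)
    show ?case
    proof (cases "\<forall>C\<in>\<C>. 2 * card C \<le> card S")
      case True
      then show ?thesis using Suc.prems(1) by blast
    next
      case False
      then obtain C where C: "C \<in> \<C>" "card S < 2 * card C" by auto
      note sp = Suc.prems(1)[unfolded splits_at_def]
      have CS: "C \<subseteq> S - {r}" using C sp by blast
      have finC: "finite C" using CS assms(2) finite_subset by blast
      obtain r' where r': "r' \<in> C" "(r, r') \<in> E" using C sp by blast
      have "connected_on E C" using C sp by blast
      then obtain \<D> where "splits_at E C r' \<D>" using ex_splits_at[OF assms(1) _ r'(1)] by blast
      note \<D> = this[unfolded splits_at_def]
      \<comment> \<open>All parts other than \<open>C\<close> hang on \<open>r\<close>, so together
        with \<open>r\<close> they form one part for the new root \<open>r'\<close>.\<close>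
      have rest: "connected_on E (S - C)"
      proof (rule connected_on_hub[OF assms(1)])
        show "r \<in> S - C" using CS sp by blast
        fix x assume x: "x \<in> S - C"
        show "(r, x) \<in> (Restr E (S - C))\<^sup>*"
        proof (cases "x = r")
          case False
          then have "x \<in> \<Union>\<C>" using x sp by simp
          then obtain D where D: "D \<in> \<C>" "x \<in> D" by blast
          then have "disjnt D C" using C x sp by (metis DiffE pairwiseD)
          then have DS: "D \<subseteq> S - C" using D sp by (auto simp: disjnt_def)
          obtain y where y: "y \<in> D" "(r, y) \<in> E" using D sp by blast
          have "(y, x) \<in> (Restr E (S - C))\<^sup>*"
            using D y sp rtrancl_Restr_mono[OF _ DS] by (auto simp: connected_on_def)
          moreover have "(r, y) \<in> Restr E (S - C)" using y DS CS sp by auto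
          ultimately show ?thesis by (rule converse_rtrancl_into_rtrancl[rotated])
        qed simp
      qed
      have "splits_at E S r' (insert (S - C) \<D>)"
        unfolding splits_at_def
      proof (intro conjI ballI)
        show "r' \<in> S" using r' CS by blast
        show "pairwise disjnt (insert (S - C) \<D>)"
          using \<D> by (auto simp: pairwise_insert disjnt_def)
        show "\<Union>(insert (S - C) \<D>) = S - {r'}" using \<D> r' CS by auto
        fix B assume B: "B \<in> insert (S - C) \<D>"
        show "connected_on E B" using B rest \<D> by blast
        show "\<exists>y\<in>B. (r', y) \<in> E"
        proof (cases "B = S - C")
          case True
          then show ?thesis using r' assms(1) CS sp by (auto dest: symD)
        qed (use B \<D> in blast)
      qed
      \<comment> \<open>The new parts are smaller than \<open>C\<close>: \<open>S - C\<close>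
        because \<open>C\<close> has more than half of the vertices, the others because they lack
        \<open>r'\<close>.\<close>
      moreover have "card B \<le> m" if "B \<in> insert (S - C) \<D>" for B
      proof (cases "B = S - C")
        case True
        have "card (S - C) = card S - card C" using CS finC by (intro card_Diff_subset) auto
        moreover have "card C \<le> Suc m" using Suc.prems(2) C by blast
        ultimately show ?thesis unfolding True using C(2) by linarith
      next
        case False
        then have "B \<subseteq> C - {r'}" using that \<D> by blast
        then have "card B \<le> card (C - {r'})" using finC by (intro card_mono) auto
        also have "\<dots> = card C - 1" using r' finC by simp
        also have "\<dots> \<le> m" using Suc.prems(2) C by auto
        finally show ?thesis .
      qed
      ultimately show ?thesis using Suc.IH[of r' "insert (S - C) \<D>"] by simp
    qed
  qed
  obtain r where r: "r \<in> S" using assms(3) by (auto simp: connected_on_def)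
  obtain \<C> where \<C>: "splits_at E S r \<C>" using ex_splits_at[OF assms(1,3) r] by blast
  have "\<forall>C\<in>\<C>. card C \<le> card S"
    using \<C> assms(2) by (auto simp: splits_at_def intro!: card_mono)
  then show ?thesis by (rule *[OF \<C>])
qed

text \<open>Bringing the tokens into their parts takes \<open>5 * card S\<close> steps,
  \<open>card S\<close> for the depth and 4 per vertex. The parts have at most half the size, so by
  induction they need at most another \<open>5 * card S\<close> in parallel.\<close>

lemma routable_connected:
  assumes "sym E" "finite S" "connected_on E S" "\<pi> permutes S"
  shows "routable (Restr E S) (10 * card S) \<pi>"
  using assms(2-4)
proof (induction "card S" arbitrary: S \<pi> rule: less_induct)
  case (less S \<pi>)
  obtain r \<C> where sp: "splits_at E S r \<C>" and half: "\<And>C. C \<in> \<C> \<Longrightarrow> 2 * card C \<le> card S"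
    using ex_balanced_split[OF assms(1) less.prems(1,2)] by blast
  have rS: "r \<in> S" and disj: "pairwise disjnt \<C>" and un: "\<Union>\<C> = S - {r}"
    and conn: "\<And>C. C \<in> \<C> \<Longrightarrow> connected_on E C"
    and nbr: "\<And>C. C \<in> \<C> \<Longrightarrow> \<exists>y\<in>C. (r, y) \<in> E"
    using sp by (auto simp: splits_at_def)
  \<comment> \<open>Each part is its own name. At \<open>r\<close> the union is empty, which no part
    is.\<close>
  define c where "c x = \<Union>{C \<in> \<C>. x \<in> C}" for x
  have c_eq: "c x = C" if "C \<in> \<C>" "x \<in> C" for x C
  proof -
    have "{C \<in> \<C>. x \<in> C} = {C}"
      using that disj by (auto simp: pairwise_def disjnt_def)
    then show ?thesis by (simp add: c_def)
  qed
  have c_r: "c r = {}" using un by (auto simp: c_def)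
  have in_part: "\<exists>C\<in>\<C>. x \<in> C" if "x \<in> S" "x \<noteq> r" for x using that un by blast
  have c_ne: "c x \<noteq> {}" if "x \<in> S" "x \<noteq> r" for x
    using in_part[OF that] c_eq by blast
  \<comment> \<open>Edges between different parts are dropped, so that tree paths below the root
    stay in one part.\<close>
  define F where "F = {(x, y) \<in> Restr E S. x = r \<or> y = r \<or> c x = c y}"
  have symF: "sym F" using assms(1) by (auto simp: F_def sym_def)
  have FS: "F \<subseteq> S \<times> S" by (auto simp: F_def)
  have FE: "F \<subseteq> Restr E S" by (auto simp: F_def)
  have reach: "(r, v) \<in> F\<^sup>*" if v: "v \<in> S" for v
  proof (cases "v = r")
    case False
    then obtain C where C: "C \<in> \<C>" "v \<in> C" using in_part v by blast
    obtain y where y: "y \<in> C" "(r, y) \<in> E" using nbr C(1) by blast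
    have CS: "C \<subseteq> S" using C(1) un by blast
    have "Restr E C \<subseteq> F"
    proof (rule subrelI)
      fix x z assume "(x, z) \<in> Restr E C"
      then have "(x, z) \<in> E" "x \<in> C" "z \<in> C" by auto
      then show "(x, z) \<in> F" using CS c_eq[OF C(1), of x] c_eq[OF C(1), of z] by (auto simp: F_def)
    qed
    moreover have "(y, v) \<in> (Restr E C)\<^sup>*"
      using conn[OF C(1)] y C by (simp add: connected_on_def)
    ultimately have "(y, v) \<in> F\<^sup>*" using rtrancl_mono by blast
    moreover have "(r, y) \<in> F" using y CS rS by (auto simp: F_def)
    ultimately show ?thesis by (rule converse_rtrancl_into_rtrancl[rotated])
  qed simp
  obtain par d where tree: "rooted_tree F S r par d"
    by (rule ex_bfs_tree[OF symF FS rS reach])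
  interpret rooted_tree F S r par d by (rule tree)
  have depth: "\<forall>u\<in>S. d u \<le> card S"
  proof
    fix u assume "u \<in> S"
    then have "{..d u} \<subseteq> d ` S" using ex_depth by blast
    then have "card {..d u} \<le> card S" using less.prems(1) by (rule surj_card_le[rotated])
    then show "d u \<le> card S" by simp
  qed
  have "\<exists>\<rho>. levelled F d (card S + 4 * card (S - {r})) 1 \<rho> \<and> (\<forall>x\<in>S. c (\<pi> (inv \<rho> x)) = c x)"
  proof (rule ex_waves_into_parts[OF less.prems(1) depth])
    show "c (par v) = c v" if "v \<in> S" "v \<noteq> r" "par v \<noteq> r" for v
      using par_edge[OF that(1,2)] that by (auto simp: F_def)
    show "c v \<noteq> c r" if "v \<in> S" "v \<noteq> r" for v using c_ne[OF that] c_r by simp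
  qed (use up_closed_S rS less.prems in auto)
  then obtain \<rho> where \<rho>: "levelled F d (card S + 4 * card (S - {r})) 1 \<rho>"
    and parts: "\<And>x. x \<in> S \<Longrightarrow> c (\<pi> (inv \<rho> x)) = c x" by blast
  have "card (S - {r}) \<le> card S" using less.prems(1) by (simp add: card_mono)
  then have route_\<rho>: "routable (Restr E S) (5 * card S) \<rho>"
    using levelled_routable[OF \<rho>] by (auto intro: routable_mono routable_mono_rel[OF _ FE])
  have \<rho>S: "\<rho> permutes S" by (rule routable_permutes[OF route_\<rho>]) auto
  define q where "q = \<pi> \<circ> inv \<rho>"
  have qS: "q permutes S" unfolding q_def using less.prems(3) \<rho>S
    by (intro permutes_compose permutes_inv)
  have q_parts: "c (q x) = c x" if "x \<in> S" for x using parts[OF that] by (simp add: q_def)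
  have q_in: "q x \<in> S" if "x \<in> S" for x using permutes_in_image[OF qS] that by simp
  have qr: "q r = r" using c_ne[OF q_in[OF rS]] q_parts[OF rS] c_r by auto
  have qU: "q permutes \<Union>\<C>"
    by (rule permutes_superset[OF qS]) (use un qr in auto)
  have "routable (Restr E (\<Union>\<C>)) (5 * card S) q"
  proof (rule routable_Restr_Union[OF _ disj qU])
    show fin: "finite (\<Union>\<C>)" using un less.prems(1) by simp
    then show "finite \<C>" by (rule finite_UnionD)
    fix C assume C: "C \<in> \<C>"
    show "q ` C \<subseteq> C"
    proof (rule image_subsetI)
      fix x assume x: "x \<in> C"
      then have xS: "x \<in> S" "x \<noteq> r" using C un by auto
      have "q x \<noteq> r" using qr xS(2) permutes_inj[OF qS] by (metis injD)
      then obtain D where "D \<in> \<C>" "q x \<in> D" using in_part q_in[OF xS(1)] by blast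
      then show "q x \<in> C" using q_parts[OF xS(1)] c_eq C x by metis
    qed
    fix \<sigma> assume \<sigma>: "\<sigma> permutes C"
    have "finite C" using C fin by (meson Union_upper finite_subset)
    moreover have "C \<subset> S" using C un rS by blast
    ultimately have "routable (Restr E C) (10 * card C) \<sigma>"
      using less.hyps[of C \<sigma>] conn[OF C] \<sigma> less.prems(1) by (simp add: psubset_card_mono)
    then show "routable (Restr E C) (5 * card S) \<sigma>"
      using half[OF C] by (auto intro: routable_mono)
  qed
  then have "routable (Restr E S) (5 * card S) q"
    using un by (auto elim!: routable_mono_rel)
  then have "routable (Restr E S) (5 * card S + 5 * card S) (q \<circ> \<rho>)"
    using routable_comp[OF route_\<rho>] by blast
  moreover have "q \<circ> \<rho> = \<pi>"
    using \<rho>S by (simp add: q_def comp_assoc permutes_inv_o)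
  ultimately show ?case by simp
qed

section \<open>Routing through a large clique\<close>

text \<open>In the inductive step \<open>p\<close> is cut out of its cycle, and the reflection that fixes \<open>\<pi> p\<close> is
  extended by the transposition of \<open>p\<close> and \<open>\<pi> p\<close>.\<close>

lemma permutes_two_involutions:
  assumes "finite S" "\<pi> permutes S" "p \<in> S"
  shows "\<exists>s t. s permutes S \<and> t permutes S \<and> s \<circ> s = id \<and> t \<circ> t = id \<and> \<pi> = s \<circ> t \<and> t p = p"
  using assms
proof (induction "card S" arbitrary: S \<pi> p)
  case 0
  then show ?case by simp
next
  case (Suc n)
  define b where "b = \<pi> p"
  define \<pi>' where "\<pi>' = transpose p b \<circ> \<pi>"
  have b: "b \<in> S" using permutes_in_image[OF Suc.prems(2)] Suc.prems(3) by (simp add: b_def)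
  have \<pi>'S: "\<pi>' permutes S"
    unfolding \<pi>'_def using Suc.prems b by (intro permutes_compose permutes_swap_id) auto
  have \<pi>': "\<pi>' permutes S - {p}"
    by (rule permutes_superset[OF \<pi>'S]) (auto simp: \<pi>'_def b_def)
  have \<pi>: "\<pi> = transpose p b \<circ> \<pi>'" by (simp add: \<pi>'_def fun_eq_iff)
  show ?case
  proof (cases "S = {p}")
    case True
    then have "\<pi> = id" using Suc.prems by simp
    then show ?thesis by (intro exI[of _ "id"] conjI) (auto simp: permutes_id)
  next
    case False
    obtain b' where b': "b' \<in> S - {p}" "b \<noteq> p \<Longrightarrow> b' = b"
      using False Suc.prems(3) b by (cases "b = p") auto
    have "\<exists>s t. s permutes S - {p} \<and> t permutes S - {p} \<and> s \<circ> s = id \<and> t \<circ> t = id \<and>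
        \<pi>' = s \<circ> t \<and> t b' = b'"
      using Suc.hyps(1)[of "S - {p}" \<pi>' b'] Suc.hyps(2) Suc.prems \<pi>' b' by simp
    then obtain s t where st: "s permutes S - {p}" "t permutes S - {p}" "s \<circ> s = id"
      "t \<circ> t = id" "\<pi>' = s \<circ> t" "t b' = b'" by blast
    have inv: "s (s x) = x" "t (t x) = x" for x using st(3,4) by (auto simp: fun_eq_iff)
    have perm: "s permutes S" "t permutes S"
      using st(1,2) by (auto intro: permutes_subset)
    have fixp: "s p = p" "t p = p" using st(1,2) by (auto simp: permutes_not_in)
    have fixb: "t b = b" using b'(2) st(6) fixp by (cases "b = p") auto
    have t_ne: "t x \<noteq> p" "t x \<noteq> b" if "x \<noteq> p" "x \<noteq> b" for x
      using that fixp fixb inv(2) by metis+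
    \<comment> \<open>\<open>t\<close> fixes \<open>p\<close> and \<open>b\<close>, hence commutes
      with their transposition, and the first factor is an involution. Conjugating \<open>s\<close>
      by \<open>t\<close> gives a second factor that fixes \<open>p\<close>.\<close>
    show ?thesis
    proof (intro exI conjI)
      show "transpose p b \<circ> t permutes S"
        using perm Suc.prems(3) b by (intro permutes_compose permutes_swap_id)
      show "t \<circ> s \<circ> t permutes S"
        using perm by (intro permutes_compose)
      show "(transpose p b \<circ> t) \<circ> (transpose p b \<circ> t) = id"
      proof
        fix x show "((transpose p b \<circ> t) \<circ> (transpose p b \<circ> t)) x = id x"
          using inv(2)[of x] t_ne[of x] fixp fixb
          by (cases "x = p"; cases "x = b") auto
      qed
      show "(t \<circ> s \<circ> t) \<circ> (t \<circ> s \<circ> t) = id" by (simp add: fun_eq_iff inv)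
      show "\<pi> = (transpose p b \<circ> t) \<circ> (t \<circ> s \<circ> t)"
        unfolding \<pi> st(5) by (simp add: fun_eq_iff inv)
      show "(t \<circ> s \<circ> t) p = p" by (simp add: fixp)
    qed
  qed
qed

text \<open>An involution of a clique is a single matching step, and two of them suffice.\<close>

lemma routable_clique:
  assumes "finite K" "\<And>x y. \<lbrakk>x \<in> K; y \<in> K; x \<noteq> y\<rbrakk> \<Longrightarrow> (x, y) \<in> E" "\<pi> permutes K"
  shows "routable E 2 \<pi>"
proof (cases "K = {}")
  case True
  then show ?thesis using assms(3) routable_id by simp
next
  case False
  then obtain p where "p \<in> K" by blast
  then obtain s t where st: "s permutes K" "t permutes K" "s \<circ> s = id" "t \<circ> t = id" "\<pi> = s \<circ> t"
    using permutes_two_involutions[OF assms(1,3)] by metis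
  have "swap_step E u" if u: "u permutes K" "u \<circ> u = id" for u
    unfolding swap_step_def
  proof (intro allI conjI impI)
    fix x show "u (u x) = x" using u(2) by (auto simp: fun_eq_iff)
    assume ne: "u x \<noteq> x"
    then have "x \<in> K" using u(1) by (metis permutes_not_in)
    then show "(x, u x) \<in> E" using assms(2) permutes_in_image[OF u(1)] ne by metis
  qed
  then have "routable E 1 s" "routable E 1 t" using st by (auto intro!: routable_step simp del: One_nat_def)
  then have "routable E (1 + 1) \<pi>" unfolding st(5) by (intro routable_comp)
  then show ?thesis by (metis one_add_one)
qed

text \<open>A breadth-first tree rooted in \<open>K\<close> has depth at most
  \<open>card (S - K) + 1\<close>; evacuation adds 4 steps per vertex of
  \<open>S - K\<close>.\<close>

lemma ex_evacuation:
  assumes "sym E" "finite S" "connected_on E S" "K \<subseteq> S" "card (S - K) < card K"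
    and clique: "\<And>x y. \<lbrakk>x \<in> K; y \<in> K; x \<noteq> y\<rbrakk> \<Longrightarrow> (x, y) \<in> E"
  shows "\<exists>\<sigma>. routable (Restr E S) (5 * card (S - K) + 1) \<sigma> \<and> \<sigma> ` (S - K) \<subseteq> K"
proof -
  obtain r where r: "r \<in> K" using assms(5) by fastforce
  have rS: "r \<in> S" using r assms(4) by blast
  have symF: "sym (Restr E S)" using assms(1) by (auto simp: sym_def)
  have reach: "(r, v) \<in> (Restr E S)\<^sup>*" if "v \<in> S" for v
    using assms(3) rS that by (simp add: connected_on_def)
  obtain par d where tree: "rooted_tree (Restr E S) S r par d"
    and par_r: "\<And>v. v \<noteq> r \<Longrightarrow> (r, v) \<in> Restr E S \<Longrightarrow> par v = r"
    by (rule ex_bfs_tree[OF symF _ rS reach]) auto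
  interpret rooted_tree "Restr E S" S r par d by (rule tree)
  have par_K: "par k = r" if "k \<in> K" "k \<noteq> r" for k
    using par_r[OF that(2)] clique[OF r that(1)] that assms(4) rS by auto
  have depth_K: "d k \<le> 1" if "k \<in> K" for k
    using depth_par[of k] par_K[OF that] depth_root that assms(4) by (cases "k = r") auto
  have depth: "\<forall>u\<in>S. d u \<le> card (S - K) + 1"
  proof
    fix u assume u: "u \<in> S"
    \<comment> \<open>\<open>K\<close> lies at depths 0 and 1, so all greater depths are realised
      outside \<open>K\<close>.\<close>
    have "{2..d u} \<subseteq> d ` (S - K)"
    proof
      fix k assume k: "k \<in> {2..d u}"
      then obtain w where "w \<in> S" "d w = k" using ex_depth[OF u, of k] by auto
      moreover have "w \<notin> K" using depth_K[of w] k \<open>d w = k\<close> by auto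
      ultimately show "k \<in> d ` (S - K)" by blast
    qed
    then have "card {2..d u} \<le> card (S - K)" using assms(2) by (intro surj_card_le) auto
    then show "d u \<le> card (S - K) + 1" by simp
  qed
  have "\<exists>\<rho>. levelled (Restr E S) d (card (S - K) + 1 + 4 * card (S - K)) 1 \<rho> \<and>
      (\<forall>x\<in>S - K. id (inv \<rho> x) \<in> K)"
  proof (rule ex_waves_evacuate[OF assms(2) depth assms(4) r par_K assms(5)])
    show "up_closed (K \<union> (S - K))" using up_closed_S assms(4) by (simp add: Un_absorb1)
    show "id permutes S" by (rule permutes_id)
  qed auto
  then obtain \<rho> where "levelled (Restr E S) d (card (S - K) + 1 + 4 * card (S - K)) 1 \<rho>"
    and \<rho>: "\<forall>x\<in>S - K. inv \<rho> x \<in> K" by auto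
  \<comment> \<open>The waves fill \<open>S - K\<close> with tokens from \<open>K\<close>, so it is
    the inverse of \<open>\<rho>\<close> that maps \<open>S - K\<close> into
    \<open>K\<close>.\<close>
  then have "routable (Restr E S) (card (S - K) + 1 + 4 * card (S - K)) (inv \<rho>)"
    by (intro routable_inv levelled_routable)
  moreover have "card (S - K) + 1 + 4 * card (S - K) = 5 * card (S - K) + 1" by simp
  ultimately show ?thesis using \<rho> by (metis image_subsetI)
qed

text \<open>
  The permutation is written as \<open>\<sigma>\<inverse> \<circ> \<rho>\<^sub>2 \<circ> \<sigma> \<circ> \<rho>\<^sub>1\<close> with \<open>\<rho>\<^sub>1\<close> and \<open>\<rho>\<^sub>2\<close> supported on \<open>K\<close>. The
  vertices of \<open>A\<close> are those that \<open>\<sigma>\<close> carries out of \<open>K\<close>, so \<open>\<rho>\<^sub>1\<close> has to bring their final tokens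
  there; these tokens are in \<open>K\<close> because \<open>\<pi>\<close> maps nothing outside \<open>K\<close> into \<open>A\<close>.
\<close>

lemma routable_conjugate:
  assumes "finite S" "K \<subseteq> S" and clique: "\<And>x y. \<lbrakk>x \<in> K; y \<in> K; x \<noteq> y\<rbrakk> \<Longrightarrow> (x, y) \<in> E"
    and \<sigma>: "routable E k \<sigma>" "\<sigma> permutes S" "\<sigma> ` (S - K) \<subseteq> K"
    and A: "A = inv \<sigma> ` (S - K)"
    and \<pi>: "\<pi> permutes S" "\<pi> ` (S - K) \<inter> A = {}"
  shows "routable E (2 * k + 4) \<pi>"
proof -
  have finK: "finite K" using assms(1,2) finite_subset by blast
  have AK: "A \<subseteq> K"
  proof
    fix a assume "a \<in> A"
    then obtain x where x: "x \<in> S" "x \<notin> K" "a = inv \<sigma> x" using A by blast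
    then have "a \<in> S" "\<sigma> a = x"
      using permutes_in_image[OF permutes_inv[OF \<sigma>(2)]] permutes_inverses(1)[OF \<sigma>(2)] by auto
    then show "a \<in> K" using \<sigma>(3) x(2) by blast
  qed
  define P where "P = inv \<pi> ` A"
  have \<pi>P: "\<pi> ` P = A" using permutes_inverses(1)[OF \<pi>(1)] by (simp add: P_def image_image)
  have PK: "P \<subseteq> K"
  proof
    fix p assume p: "p \<in> P"
    then have "\<pi> p \<in> A" using \<pi>P by blast
    moreover have "p \<in> S"
      using p AK assms(2) permutes_in_image[OF permutes_inv[OF \<pi>(1)]] by (auto simp: P_def)
    ultimately show "p \<in> K" using \<pi>(2) by blast
  qed
  have bijPA: "bij_betw \<pi> P A"
    using \<pi>P permutes_inj_on[OF \<pi>(1)] by (simp add: bij_betw_def)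
  have "card (K - P) = card (K - A)"
    using bij_betw_same_card[OF bijPA] PK AK finK
    by (metis card_Diff_subset finite_subset)
  then obtain g where g: "bij_betw g (K - P) (K - A)"
    using finK by (meson finite_Diff finite_same_card_bij)
  define \<rho>1 where "\<rho>1 x = (if x \<in> P then \<pi> x else if x \<in> K then g x else x)" for x
  have "bij_betw \<rho>1 (P \<union> (K - P)) (A \<union> (K - A))"
  proof (rule bij_betw_combine)
    show "bij_betw \<rho>1 P A" using bijPA by (simp add: \<rho>1_def cong: bij_betw_cong)
    show "bij_betw \<rho>1 (K - P) (K - A)" using g by (subst bij_betw_cong[of _ _ g]) (auto simp: \<rho>1_def)
  qed auto
  then have "bij_betw \<rho>1 K K" using PK AK by (simp add: Un_absorb1)
  then have \<rho>1: "\<rho>1 permutes K" using PK by (intro bij_imp_permutes) (auto simp: \<rho>1_def)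
  \<comment> \<open>The desired product forces this choice. It fixes vertices outside
    \<open>K\<close> because \<open>\<rho>1\<close> agrees with \<open>\<pi>\<close> on
    \<open>P\<close>.\<close>
  define \<rho>2 where "\<rho>2 = \<sigma> \<circ> \<pi> \<circ> inv \<rho>1 \<circ> inv \<sigma>"
  have "\<rho>2 permutes S" unfolding \<rho>2_def
    using \<sigma>(2) \<pi>(1) permutes_subset[OF \<rho>1 assms(2)] by (intro permutes_compose permutes_inv)
  then have \<rho>2: "\<rho>2 permutes K"
  proof (rule permutes_superset)
    fix x assume "x \<in> S - K"
    then have a: "inv \<sigma> x \<in> A" using A by blast
    then obtain p where p: "p \<in> P" "\<pi> p = inv \<sigma> x" using \<pi>P by (metis imageE)
    then have "inv \<rho>1 (inv \<sigma> x) = p"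
      using permutes_inverses(2)[OF \<rho>1, of p] by (simp add: \<rho>1_def)
    then show "\<rho>2 x = x" using p permutes_inverses(1)[OF \<sigma>(2)] by (simp add: \<rho>2_def)
  qed
  have "inv \<sigma> \<circ> (\<rho>2 \<circ> (\<sigma> \<circ> \<rho>1)) = \<pi>"
    using permutes_inverses(2)[OF \<sigma>(2)] permutes_inverses(2)[OF \<rho>1]
    by (auto simp: fun_eq_iff \<rho>2_def)
  moreover have "routable E (2 + k + 2 + k) (inv \<sigma> \<circ> (\<rho>2 \<circ> (\<sigma> \<circ> \<rho>1)))"
    using routable_clique[OF finK clique] \<rho>1 \<rho>2 \<sigma>(1) by (intro routable_comp routable_inv) auto
  moreover have "2 + k + 2 + k = 2 * k + 4" by simp
  ultimately show ?thesis by metis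
qed

lemma ex_swap_sets:
  assumes "finite A" "card A = card B" "A \<inter> B = {}" "finite B"
  shows "\<exists>\<tau>. \<tau> permutes (A \<union> B) \<and> \<tau> \<circ> \<tau> = id \<and> \<tau> ` A = B"
proof -
  obtain f where f: "bij_betw f A B" using assms by (meson finite_same_card_bij)
  define h where "h = inv_into A f"
  have h: "h (f x) = x" "f x \<in> B" if "x \<in> A" for x
    using f that by (auto simp: h_def bij_betw_def)
  have h': "f (h x) = x" "h x \<in> A" if "x \<in> B" for x
    using f that by (auto simp: h_def bij_betw_def f_inv_into_f inv_into_into)
  define \<tau> where "\<tau> x = (if x \<in> A then f x else if x \<in> B then h x else x)" for x
  have inv: "\<tau> (\<tau> x) = x" for x
    using h[of x] h'[of x] assms(3) by (auto simp: \<tau>_def)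
  have "\<tau> permutes (A \<union> B)"
    unfolding permutes_def using inv by (metis UnI1 UnI2 \<tau>_def)
  moreover have "\<tau> ` A = B" using f by (simp add: \<tau>_def bij_betw_def)
  ultimately show ?thesis using inv by (intro exI[of _ \<tau>]) (auto simp: fun_eq_iff)
qed

text \<open>The involution \<open>\<tau>\<close> exchanges \<open>S - K\<close> with a set
  \<open>B\<close> in \<open>K\<close> that avoids \<open>A\<close> and its preimage under
  \<open>\<pi>\<close>. Then \<open>\<tau>\<close> and \<open>\<pi> \<circ> \<tau>\<close> both meet
  the condition of \<open>routable_conjugate\<close>, and their product is
  \<open>\<pi>\<close>.\<close>

lemma routable_large_clique:
  assumes "sym E" "finite S" "connected_on E S" "K \<subseteq> S" "K \<noteq> {}" "3 * card (S - K) \<le> card K"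
    and clique: "\<And>x y. \<lbrakk>x \<in> K; y \<in> K; x \<noteq> y\<rbrakk> \<Longrightarrow> (x, y) \<in> E"
    and \<pi>: "\<pi> permutes S"
  shows "routable (Restr E S) (20 * card (S - K) + 12) \<pi>"
proof -
  have finK: "finite K" using assms(2,4) finite_subset by blast
  have "0 < card K" using assms(5) finK by (simp add: card_gt_0_iff)
  then have "card (S - K) < card K" using assms(6) by linarith
  then obtain \<sigma> where \<sigma>: "routable (Restr E S) (5 * card (S - K) + 1) \<sigma>" "\<sigma> ` (S - K) \<subseteq> K"
    using ex_evacuation[OF assms(1-4) _ clique] by blast
  have \<sigma>S: "\<sigma> permutes S" by (rule routable_permutes[OF \<sigma>(1)]) auto
  define A where "A = inv \<sigma> ` (S - K)"
  have cA: "card A = card (S - K)"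
    unfolding A_def by (intro card_image permutes_inj_on[OF permutes_inv[OF \<sigma>S]])
  have cA': "card (inv \<pi> ` A) = card A"
    by (intro card_image permutes_inj_on[OF permutes_inv[OF \<pi>]])
  have finA: "finite A" using assms(2) by (simp add: A_def)
  have "card K - card (A \<union> inv \<pi> ` A) \<le> card (K - (A \<union> inv \<pi> ` A))"
    by (rule diff_card_le_card_Diff) (use finA in simp)
  moreover have "card (A \<union> inv \<pi> ` A) \<le> card A + card (inv \<pi> ` A)" by (rule card_Un_le)
  \<comment> \<open>\<open>A\<close> and its preimage occupy at most two of the three times
    \<open>card (S - K)\<close> vertices available in \<open>K\<close>.\<close>
  ultimately have "card (S - K) \<le> card (K - (A \<union> inv \<pi> ` A))"
    using assms(6) cA cA' by linarith
  then obtain B where B: "B \<subseteq> K - (A \<union> inv \<pi> ` A)" "card B = card (S - K)"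
    by (rule obtain_subset_with_card_n)
  have finB: "finite B" using B(1) finK finite_subset by blast
  obtain \<tau> where \<tau>: "\<tau> permutes ((S - K) \<union> B)" "\<tau> \<circ> \<tau> = id" "\<tau> ` (S - K) = B"
    using ex_swap_sets[of "S - K" B] B assms(2) finB by auto
  have \<tau>S: "\<tau> permutes S"
    by (rule permutes_subset[OF \<tau>(1)]) (use B assms(4) in auto)
  have clique': "(x, y) \<in> Restr E S" if "x \<in> K" "y \<in> K" "x \<noteq> y" for x y
    using clique[OF that] that assms(4) by auto
  note conj = routable_conjugate[OF assms(2,4) clique' \<sigma>(1) \<sigma>S \<sigma>(2) A_def]
  have 1: "routable (Restr E S) (2 * (5 * card (S - K) + 1) + 4) \<tau>"
    by (rule conj[OF _ _ _ \<tau>S]) (use B \<tau>(3) in auto)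
  have 2: "routable (Restr E S) (2 * (5 * card (S - K) + 1) + 4) (\<pi> \<circ> \<tau>)"
  proof (rule conj)
    show "\<pi> \<circ> \<tau> permutes S" using \<pi> \<tau>S by (intro permutes_compose)
    have "\<pi> b \<notin> A" if "b \<in> B" for b
      using that B(1) permutes_inverses(2)[OF \<pi>, of b] by (metis DiffD2 UnCI image_eqI subsetD)
    then show "(\<pi> \<circ> \<tau>) ` (S - K) \<inter> A = {}" using \<tau>(3) by (auto simp: image_comp[symmetric])
  qed
  have "(\<pi> \<circ> \<tau>) \<circ> \<tau> = \<pi>" using \<tau>(2) by (simp add: comp_assoc)
  then show ?thesis using routable_comp[OF 1 2] by (simp add: add.commute)
qed

text \<open>Let m be \<open>card (S - K)\<close>. For a large clique, 20 m + 12 is at most 40 max(m,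
  1). Otherwise \<open>card S\<close> is below 4 m, and the linear bound gives 40 m.\<close>

lemma routable_connected_clique:
  assumes "sym E" "finite S" "connected_on E S" "K \<subseteq> S" "K \<noteq> {}"
    and clique: "\<And>x y. \<lbrakk>x \<in> K; y \<in> K; x \<noteq> y\<rbrakk> \<Longrightarrow> (x, y) \<in> E"
    and "\<pi> permutes S"
  shows "routable (Restr E S) (40 * max (card S - card K) 1) \<pi>"
proof -
  have finK: "finite K" using assms(2,4) finite_subset by blast
  have m: "card (S - K) = card S - card K" using assms(4) finK by (simp add: card_Diff_subset)
  have le: "card K \<le> card S" using assms(2,4) by (simp add: card_mono)
  show ?thesis
  proof (cases "3 * card (S - K) \<le> card K")
    case True
    have "routable (Restr E S) (20 * card (S - K) + 12) \<pi>"
      by (rule routable_large_clique[OF assms(1-5) True _ assms(7)]) (rule clique)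
    moreover have "20 * card (S - K) + 12 \<le> 40 * max (card S - card K) 1" using m by simp
    ultimately show ?thesis by (rule routable_mono)
  next
    case False
    then have "10 * card S \<le> 40 * max (card S - card K) 1" using m le by simp
    then show ?thesis
      by (rule routable_mono[OF routable_connected[OF assms(1-3,7)]])
  qed
qed

section \<open>Routing numbers\<close>

lemma ex_matching_of_swap_step:
  assumes "swap_step (parcs G) s"
  shows "\<exists>M. is_matching G M \<and> swap_along M = s"
proof -
  define M where "M = {{x, s x} | x. s x \<noteq> x}"
  have inv: "s (s x) = x" for x using assms by (simp add: swap_step_def)
  have "M \<subseteq> edges G" using assms by (auto simp: M_def edges_def swap_step_def)
  moreover have "pairwise disjnt M"
  proof (rule pairwiseI)
    fix e f assume "e \<in> M" "f \<in> M" "e \<noteq> f"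
    then obtain x y where "e = {x, s x}" "f = {y, s y}" by (auto simp: M_def)
    then show "disjnt e f" using inv \<open>e \<noteq> f\<close> by (auto simp: disjnt_def) (metis insert_commute)+
  qed
  ultimately have M: "is_matching G M" by (simp add: is_matching_def)
  have "swap_along M x = s x" for x
  proof (cases "s x = x")
    case True
    then have "\<nexists>v. {x, v} \<in> M" using inv by (auto simp: M_def doubleton_eq_iff)
    then show ?thesis using True by (simp add: swap_along_def)
  next
    case False
    then show ?thesis using swap_along_edge[OF M, of x "s x"] by (auto simp: M_def)
  qed
  then show ?thesis using M by blast
qed

lemma ex_matchings_of_routable:
  "routable (parcs G) k \<pi> \<Longrightarrow>
    \<exists>Ms. length Ms = k \<and> (\<forall>M\<in>set Ms. is_matching G M) \<and> (\<forall>v. fold swap_along Ms v = \<pi> v)"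
proof (induction k arbitrary: \<pi>)
  case (Suc k)
  then obtain s \<rho> where s: "swap_step (parcs G) s" "routable (parcs G) k \<rho>" "\<pi> = \<rho> \<circ> s"
    by (auto simp: routable.simps(2))
  obtain Ms where Ms: "length Ms = k" "\<forall>M\<in>set Ms. is_matching G M"
    "\<forall>v. fold swap_along Ms v = \<rho> v" using Suc.IH[OF s(2)] by blast
  obtain M where M: "is_matching G M" "swap_along M = s"
    using ex_matching_of_swap_step[OF s(1)] by blast
  show ?case by (intro exI[of _ "M # Ms"]) (use Ms M s(3) in auto)
qed simp

lemma routing_number_le:
  assumes "\<And>\<pi>. \<pi> permutes pverts G \<Longrightarrow> routable (parcs G) k \<pi>"
  shows "routing_number G \<le> enat k"
  unfolding routing_number_def
proof (rule SUP_least)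
  fix \<pi> assume "\<pi> \<in> {\<pi>. \<pi> permutes pverts G}"
  then obtain Ms where "length Ms = k" "routes G \<pi> Ms"
    using ex_matchings_of_routable[OF assms] unfolding routes_def by blast
  then show "routing_number_perm G \<pi> \<le> enat k"
    unfolding routing_number_perm_def by (metis (mono_tags, lifting) INF_lower mem_Collect_eq)
qed

text \<open>The library defines connectivity through the symmetric closure, which changes nothing
  here because the arcs are already symmetric.\<close>

lemma (in pair_graph) connected_on_pverts:
  assumes "Digraph_Component.connected (with_proj G)"
  shows "connected_on (parcs G) (pverts G)"
proof -
  have symm: "sym (parcs G)"
    using sym_arcs by (simp add: symmetric_def)
  have parcs_eq: "parcs (mk_symmetric (with_proj G)) = parcs G"
    using symm by (auto simp: parcs_mk_symmetric dest: symD)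
  have Restr_eq: "Restr (parcs G) (pverts G) = parcs G"
    using arc_fst_in_verts arc_snd_in_verts by fastforce
  have sc: "strongly_connected (with_proj (mk_symmetric (with_proj G)))"
    using assms by (simp add: Digraph_Component.connected_def)
  have "(u, v) \<in> (parcs G)\<^sup>*" if "u \<in> pverts G" "v \<in> pverts G" for u v
    using sc that reachable_rtranclI[of "with_proj (mk_symmetric (with_proj G))" u v]
    by (simp add: strongly_connected_def parcs_eq)
  then show ?thesis
    using sc by (simp add: connected_on_def Restr_eq strongly_connected_def)
qed

lemma ex_maximum_clique:
  assumes "finite (pverts G)" "pverts G \<noteq> {}"
  shows "\<exists>K. is_clique G K \<and> K \<noteq> {} \<and> card K = clique_number G"
proof -
  have fin: "finite {card K | K. is_clique G K}"
    by (rule finite_subset[of _ "card ` Pow (pverts G)"]) (use assms in \<open>auto simp: is_clique_def\<close>)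
  obtain v where "v \<in> pverts G" using assms(2) by blast
  then have "is_clique G {v}" by (simp add: is_clique_def)
  then have 1: "card {v} \<in> {card K | K. is_clique G K}" by blast
  then have "clique_number G \<in> {card K | K. is_clique G K}"
    unfolding clique_number_def using fin by (intro Max_in) auto
  then obtain K where "is_clique G K" "card K = clique_number G" by auto
  moreover have "1 \<le> clique_number G" unfolding clique_number_def using Max_ge[OF fin 1] by simp
  ultimately show ?thesis by (metis card.empty not_one_le_zero)
qed

theorem theorem6:
  shows "\<exists>c::real. c > 0 \<and>
    (\<forall>(n::nat) (G :: nat pair_pre_digraph).
       pair_graph G \<and> pverts G = {1..n} \<and> Digraph_Component.connected (with_proj G) \<longrightarrow>
       ereal_of_enat (routing_number G)
         \<le> ereal (c * max (real n - real (clique_number G)) 1))"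
proof (intro exI[of _ 40] conjI allI impI)
  fix n :: nat and G :: "nat pair_pre_digraph"
  assume G: "pair_graph G \<and> pverts G = {1..n} \<and> Digraph_Component.connected (with_proj G)"
  then interpret pair_graph G by simp
  have conn: "connected_on (parcs G) (pverts G)" using connected_on_pverts G by blast
  have fin: "finite (pverts G)" using G by simp
  have cardV: "card (pverts G) = n" using G by simp
  obtain K where K: "is_clique G K" "K \<noteq> {}" "card K = clique_number G"
    using ex_maximum_clique[OF fin] conn by (auto simp: connected_on_def)
  have KV: "K \<subseteq> pverts G" using K(1) by (simp add: is_clique_def)
  have adj: "(x, y) \<in> parcs G" if "x \<in> K" "y \<in> K" "x \<noteq> y" for x y
    using K(1) that by (auto simp: is_clique_def pairwise_def)
  have symm: "sym (parcs G)"
    using sym_arcs by (simp add: symmetric_def)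
  have "routable (parcs G) (40 * max (n - clique_number G) 1) \<pi>" if "\<pi> permutes pverts G" for \<pi>
  proof -
    have "routable (Restr (parcs G) (pverts G)) (40 * max (card (pverts G) - card K) 1) \<pi>"
      by (rule routable_connected_clique[OF symm fin conn KV K(2) _ that]) (rule adj)
    then show ?thesis unfolding K(3) cardV by (rule routable_mono_rel) auto
  qed
  then have "ereal_of_enat (routing_number G)
      \<le> ereal_of_enat (enat (40 * max (n - clique_number G) 1))"
    unfolding ereal_of_enat_le_iff by (rule routing_number_le)
  \<comment> \<open>The truncated subtraction agrees with the real one because the clique number is
    at most \<open>n\<close>.\<close>
  also have "\<dots> = ereal (40 * max (real n - real (clique_number G)) 1)"
    using card_mono[OF fin KV] by (simp add: K(3) cardV of_nat_diff of_nat_max)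
  finally show "ereal_of_enat (routing_number G)
      \<le> ereal (40 * max (real n - real (clique_number G)) 1)" .
qed simp

end
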